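(* Let $\mathbf{A}=(A,\cdot)$ be a finite nilpotent loop. Then $\mathbf{A}$ has a supernilpotent loop reduct, i.e. there is a binary term operation $*$ of $\mathbf{A}$ such that $(A,* )$ is a supernilpotent loop.
   Context: An algebra $\mathbf{A}=(A,F)$ is a set $A$ with a list $F$ of basic operations. A term operation of $\mathbf{A}$ is a finitary operation on $A$ obtained by composing basic operations and projections; a polynomial operation is obtained by composing basic operations, projections and constants. An algebra $(A,G)$ is a reduct of $\mathbf{A}$ if every operation in $G$ is a term operation of $\mathbf{A}$. A loop is an algebra $(A,\cdot,\backslash,/,1)$ satisfying $x\backslash(xy)=y$, $x(x\backslash y)=y$, $(yx)/x=y$, $(y/x)x=y$, $x\cdot 1=1\cdot x=x$; equivalently a groupoid $(A,\cdot)$ with identity $1$ such that for all $a,b\in A$ the equations $ax=b$ and $ya=b$ have unique solutions. A finite loop $(A,\cdot,\backslash,/,1)$ has the same term operations as $(A,\cdot)$, so the two presentations are not distinguished. Commutators: for congruences $\alpha_1,\dots,\alpha_n$ ($n\ge 2$) of an algebra $\mathbf{A}$, the ($n$-ary, term condition) commutator $[\alpha_1,\dots,\alpha_n]$ is the smallest congruence $\delta$ such that for all polynomial operations $f$ of $\mathbf{A}$ (with variables split into $n$ blocks) and all tuples $a_i,b_i$ of the corresponding block lengths that are coordinatewise congruent modulo $\alpha_i$: if $f(x_1,\dots,x_{n-1},a_n)\equiv_\delta f(x_1,\dots,x_{n-1},b_n)$ for all $(x_1,\dots,x_{n-1})\in\prod_{i<n}\{a_i,b_i\}$ different from $(b_1,\dots,b_{n-1})$,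 then $f(b_1,\dots,b_{n-1},a_n)\equiv_\delta f(b_1,\dots,b_{n-1},b_n)$. Let $0_A$ be equality and $1_A$ the total congruence. $\mathbf{A}$ is nilpotent if for some $k\ge 1$ there are congruences $1_A=\alpha_0\ge\alpha_1\ge\dots\ge\alpha_k=0_A$ with $[\alpha_i,1_A]\le\alpha_{i+1}$ for all $i<k$. (For loops this is the same as central nilpotence in the sense of Bruck.) $\mathbf{A}$ is supernilpotent if for some $k\ge 1$ the $(k+1)$-ary commutator $[1_A,\dots,1_A]$ equals $0_A$. (It is known that a finite loop is supernilpotent iff it is a direct product of nilpotent loops of prime power order.) *)

theory Defs
  imports Main
begin

text \<open>An algebra is a universe \<open>A\<close> together with a set \<open>F\<close> of basic operations, each given as a
  pair of its arity \<open>n\<close> and a function on lists, of which only the values on lists of length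
  \<open>n\<close> over \<open>A\<close> matter.\<close>

type_synonym 'a operation = "nat \<times> ('a list \<Rightarrow> 'a)"

definition is_algebra :: "'a set \<Rightarrow> 'a operation set \<Rightarrow> bool" where
  "is_algebra A F \<longleftrightarrow>
     (\<forall>(n, f) \<in> F. \<forall>xs. length xs = n \<and> set xs \<subseteq> A \<longrightarrow> f xs \<in> A)"

text \<open>The rule \<open>ext\<close> identifies functions that agree on the \<open>n\<close>-tuples over \<open>A\<close>, i.e. that
  represent the same \<open>n\<close>-ary operation on \<open>A\<close>.\<close>

inductive term_operation :: "'a set \<Rightarrow> 'a operation set \<Rightarrow> nat \<Rightarrow> ('a list \<Rightarrow> 'a) \<Rightarrow> bool"
  for A F n where
  proj: "i < n \<Longrightarrow> term_operation A F n (\<lambda>xs. xs ! i)"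
| comp: "(k, f) \<in> F \<Longrightarrow> length gs = k \<Longrightarrow> \<forall>g \<in> set gs. term_operation A F n g
         \<Longrightarrow> term_operation A F n (\<lambda>xs. f (map (\<lambda>g. g xs) gs))"
| ext: "term_operation A F n g \<Longrightarrow> (\<And>xs. length xs = n \<Longrightarrow> set xs \<subseteq> A \<Longrightarrow> f xs = g xs)
         \<Longrightarrow> term_operation A F n f"

definition polynomial_operation ::
    "'a set \<Rightarrow> 'a operation set \<Rightarrow> nat \<Rightarrow> ('a list \<Rightarrow> 'a) \<Rightarrow> bool" where
  "polynomial_operation A F = term_operation A (F \<union> {(0, \<lambda>_. a) | a. a \<in> A})"

definition is_congruence :: "'a set \<Rightarrow> 'a operation set \<Rightarrow> 'a rel \<Rightarrow> bool" where
  "is_congruence A F \<theta> \<longleftrightarrow> equiv A \<theta> \<and>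
     (\<forall>(n, f) \<in> F. \<forall>xs ys. length xs = n \<and> list_all2 (\<lambda>x y. (x, y) \<in> \<theta>) xs ys
        \<longrightarrow> (f xs, f ys) \<in> \<theta>)"

text \<open>In the \<open>n\<close>-ary term condition, \<open>n\<close> is the length of \<open>\<alpha>s\<close>, the tuples \<open>a\<^sub>i\<close>, \<open>b\<^sub>i\<close> are the
  lists \<open>as ! i\<close>, \<open>bs ! i\<close>, and the last block is the distinguished one. The tuples
  \<open>(x\<^sub>1, \<dots>, x\<^sub>n\<^sub>-\<^sub>1)\<close> in the product of the \<open>{a\<^sub>i, b\<^sub>i}\<close> are given by choice functions \<open>c\<close>, and the
  excluded one is the choice of all \<open>b\<^sub>i\<close>. Excluding it as a choice rather than as a value matters
  when some \<open>a\<^sub>i = b\<^sub>i\<close>: otherwise \<open>a\<^sub>i = b\<^sub>i\<close> for all \<open>i < n\<close> would make the premise vacuous and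
  force \<open>\<delta>\<close> to contain the last congruence.\<close>

definition choose_blocks :: "(nat \<Rightarrow> bool) \<Rightarrow> 'a list list \<Rightarrow> 'a list list \<Rightarrow> 'a list list" where
  "choose_blocks c as bs = map (\<lambda>i. if c i then bs ! i else as ! i) [0..<length as - 1]"

definition term_condition :: "'a set \<Rightarrow> 'a operation set \<Rightarrow> 'a rel list \<Rightarrow> 'a rel \<Rightarrow> bool" where
  "term_condition A F \<alpha>s \<delta> \<longleftrightarrow>
     (\<forall>f as bs.
        length as = length \<alpha>s \<and> length bs = length \<alpha>s \<and>
        (\<forall>i < length \<alpha>s. list_all2 (\<lambda>x y. (x, y) \<in> \<alpha>s ! i) (as ! i) (bs ! i)) \<and>
        polynomial_operation A F (length (concat as)) f \<and>
        (\<forall>c. (\<exists>i < length \<alpha>s - 1. \<not> c i)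
             \<longrightarrow> (f (concat (choose_blocks c as bs) @ last as),
                  f (concat (choose_blocks c as bs) @ last bs)) \<in> \<delta>)
        \<longrightarrow> (f (concat (butlast bs) @ last as), f (concat (butlast bs) @ last bs)) \<in> \<delta>)"

definition commutator :: "'a set \<Rightarrow> 'a operation set \<Rightarrow> 'a rel list \<Rightarrow> 'a rel" where
  "commutator A F \<alpha>s = (LEAST \<delta>. is_congruence A F \<delta> \<and> term_condition A F \<alpha>s \<delta>)"

text \<open>The least congruence in this definition exists, so that \<open>LEAST\<close> is meaningful.\<close>

lemma term_operation_closed:
  assumes "term_operation A F n f" "is_algebra A F" "length xs = n" "set xs \<subseteq> A"
  shows "f xs \<in> A"
  using assms
proof (induction rule: term_operation.induct)
  case (comp k f gs)
  moreover have "set (map (\<lambda>g. g xs) gs) \<subseteq> A"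
    using comp by auto
  ultimately show ?case
    unfolding is_algebra_def by (metis (mono_tags, lifting) case_prodD length_map)
qed (auto simp: subset_iff)

lemma is_congruence_total: "is_algebra A F \<Longrightarrow> is_congruence A F (A \<times> A)"
  unfolding is_congruence_def is_algebra_def
  by (fastforce simp: equiv_def refl_on_def sym_def trans_def list_all2_conv_all_nth
      in_set_conv_nth subset_iff)

lemma term_condition_total:
  assumes alg: "is_algebra A F" and sub: "\<And>\<alpha>. \<alpha> \<in> set \<alpha>s \<Longrightarrow> \<alpha> \<subseteq> A \<times> A" and ne: "\<alpha>s \<noteq> []"
  shows "term_condition A F \<alpha>s (A \<times> A)"
  unfolding term_condition_def
proof (intro allI impI, elim conjE)
  fix f as bs
  assume len: "length as = length \<alpha>s" "length bs = length \<alpha>s"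
    and rel: "\<forall>i < length \<alpha>s. list_all2 (\<lambda>x y. (x, y) \<in> \<alpha>s ! i) (as ! i) (bs ! i)"
    and pol: "polynomial_operation A F (length (concat as)) f"
  have el: "length (as ! i) = length (bs ! i) \<and> set (as ! i) \<subseteq> A \<and> set (bs ! i) \<subseteq> A"
    if "i < length \<alpha>s" for i
    using rel that sub[of "\<alpha>s ! i"]
    by (fastforce simp: list_all2_conv_all_nth in_set_conv_nth)
  have alg': "is_algebra A (F \<union> {(0, \<lambda>_. a) | a. a \<in> A})"
    using alg by (auto simp: is_algebra_def)
  have cl: "f ys \<in> A" if "length ys = length (concat as)" "set ys \<subseteq> A" for ys
    using term_operation_closed[OF pol[unfolded polynomial_operation_def] alg' that] .
  have nea: "as \<noteq> []" "bs \<noteq> []"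
    using len ne by auto
  have setA: "\<forall>z \<in> set as. set z \<subseteq> A" "\<forall>z \<in> set bs. set z \<subseteq> A"
    using el len by (metis in_set_conv_nth)+
  have map_len: "map length as = map length bs"
    using el len by (simp add: list_eq_iff_nth_eq)
  have bl: "map length (butlast as) = map length (butlast bs)"
    using map_len by (metis map_butlast)
  have la: "length (last as) = length (last bs)"
    using map_len nea by (metis last_map)
  have l: "length (concat as) = length (concat (butlast as)) + length (last as)"
    using nea by (metis append_butlast_last_id concat.simps concat_append length_append append_Nil2)
  have c: "length (concat (butlast bs)) = length (concat (butlast as))"
    using bl by (simp add: length_concat)
  have "set (concat (butlast bs) @ last as) \<subseteq> A" "set (concat (butlast bs) @ last bs) \<subseteq> A"
    using setA nea by (auto dest!: in_set_butlastD)
  then show "(f (concat (butlast bs) @ last as), f (concat (butlast bs) @ last bs)) \<in> A \<times> A"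
    using cl l c la by simp
qed

lemma commutator_least:
  assumes alg: "is_algebra A F" and sub: "\<And>\<alpha>. \<alpha> \<in> set \<alpha>s \<Longrightarrow> \<alpha> \<subseteq> A \<times> A" and ne: "\<alpha>s \<noteq> []"
  shows "is_congruence A F (commutator A F \<alpha>s)" "term_condition A F \<alpha>s (commutator A F \<alpha>s)"
    and "\<And>\<delta>. is_congruence A F \<delta> \<Longrightarrow> term_condition A F \<alpha>s \<delta> \<Longrightarrow> commutator A F \<alpha>s \<subseteq> \<delta>"
proof -
  let ?P = "\<lambda>\<delta>. is_congruence A F \<delta> \<and> term_condition A F \<alpha>s \<delta>"
  let ?D = "\<Inter>{\<delta>. ?P \<delta>}"
  have top: "?P (A \<times> A)"
    using is_congruence_total[OF alg] term_condition_total[OF assms] by blast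
  have "equiv A ?D"
  proof (rule equivI)
    show "?D \<subseteq> A \<times> A" using top by blast
    show "refl_on A ?D"
      by (auto simp: refl_on_def is_congruence_def equiv_def)
    show "sym ?D"
      by (rule symI) (auto simp: is_congruence_def equiv_def dest: symD)
    show "trans ?D"
      by (rule transI) (auto simp: is_congruence_def equiv_def dest: transD)
  qed
  moreover have "(f xs, f ys) \<in> ?D"
    if "(n, f) \<in> F" "length xs = n" "list_all2 (\<lambda>x y. (x, y) \<in> ?D) xs ys" for n f xs ys
  proof
    fix \<delta> assume d: "\<delta> \<in> {\<delta>. ?P \<delta>}"
    have "list_all2 (\<lambda>x y. (x, y) \<in> \<delta>) xs ys"
      using that(3) by (rule list_all2_mono) (use d in blast)
    then show "(f xs, f ys) \<in> \<delta>"
      using d that unfolding is_congruence_def by blast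
  qed
  ultimately have cong: "is_congruence A F ?D"
    unfolding is_congruence_def by blast
  have tc: "term_condition A F \<alpha>s ?D"
  proof (rule term_condition_def[THEN iffD2], intro allI impI InterI)
    fix f as bs \<delta>
    assume h: "length as = length \<alpha>s \<and> length bs = length \<alpha>s \<and>
        (\<forall>i < length \<alpha>s. list_all2 (\<lambda>x y. (x, y) \<in> \<alpha>s ! i) (as ! i) (bs ! i)) \<and>
        polynomial_operation A F (length (concat as)) f \<and>
        (\<forall>c. (\<exists>i < length \<alpha>s - 1. \<not> c i) \<longrightarrow>
                (f (concat (choose_blocks c as bs) @ last as),
                 f (concat (choose_blocks c as bs) @ last bs)) \<in> ?D)"
      and d: "\<delta> \<in> {\<delta>. ?P \<delta>}"
    have "\<forall>c. (\<exists>i < length \<alpha>s - 1. \<not> c i) \<longrightarrow>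
                (f (concat (choose_blocks c as bs) @ last as),
                 f (concat (choose_blocks c as bs) @ last bs)) \<in> \<delta>"
      using h d by blast
    moreover have "term_condition A F \<alpha>s \<delta>"
      using d by blast
    ultimately show "(f (concat (butlast bs) @ last as), f (concat (butlast bs) @ last bs)) \<in> \<delta>"
      using h unfolding term_condition_def by blast
  qed
  have "commutator A F \<alpha>s = ?D"
    unfolding commutator_def
  proof (rule Least_equality)
    show "?P ?D" using cong tc by blast
    show "?D \<subseteq> \<delta>" if "?P \<delta>" for \<delta> using that by blast
  qed
  then show "is_congruence A F (commutator A F \<alpha>s)" "term_condition A F \<alpha>s (commutator A F \<alpha>s)"
    and "\<And>\<delta>. is_congruence A F \<delta> \<Longrightarrow> term_condition A F \<alpha>s \<delta> \<Longrightarrow> commutator A F \<alpha>s \<subseteq> \<delta>"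
    using cong tc by auto
qed

definition is_nilpotent :: "'a set \<Rightarrow> 'a operation set \<Rightarrow> bool" where
  "is_nilpotent A F \<longleftrightarrow>
     (\<exists>k \<ge> 1. \<exists>\<alpha> :: nat \<Rightarrow> 'a rel.
        (\<forall>i \<le> k. is_congruence A F (\<alpha> i)) \<and> \<alpha> 0 = A \<times> A \<and> \<alpha> k = Id_on A \<and>
        (\<forall>i < k. \<alpha> (Suc i) \<subseteq> \<alpha> i \<and> commutator A F [\<alpha> i, A \<times> A] \<subseteq> \<alpha> (Suc i)))"

definition is_supernilpotent :: "'a set \<Rightarrow> 'a operation set \<Rightarrow> bool" where
  "is_supernilpotent A F \<longleftrightarrow>
     (\<exists>k \<ge> 1. commutator A F (replicate (k + 1) (A \<times> A)) = Id_on A)"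

definition binary :: "('a \<Rightarrow> 'a \<Rightarrow> 'a) \<Rightarrow> 'a list \<Rightarrow> 'a" where
  "binary m xs = m (xs ! 0) (xs ! 1)"

text \<open>Loops are taken in the presentation \<open>(A, \<cdot>)\<close>; for finite \<open>A\<close> the divisions and the identity
  are term operations of \<open>(A, \<cdot>)\<close>.\<close>

definition is_loop :: "'a set \<Rightarrow> ('a \<Rightarrow> 'a \<Rightarrow> 'a) \<Rightarrow> bool" where
  "is_loop A m \<longleftrightarrow>
     (\<forall>x \<in> A. \<forall>y \<in> A. m x y \<in> A) \<and>
     (\<exists>e \<in> A. \<forall>x \<in> A. m e x = x \<and> m x e = x) \<and>
     (\<forall>a \<in> A. \<forall>b \<in> A. (\<exists>!x. x \<in> A \<and> m a x = b) \<and> (\<exists>!y. y \<in> A \<and> m y a = b))"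

definition groupoid_operations :: "('a \<Rightarrow> 'a \<Rightarrow> 'a) \<Rightarrow> 'a operation set" where
  "groupoid_operations m = {(2, binary m)}"

end

theory Submission
  imports Defs "HOL-Number_Theory.Residues"
begin

text \<open>
  A finite nilpotent loop has a chain of central extensions by cyclic groups of prime order. Choosing
  representatives at each stage gives coordinates \<open>\<kappa>\<^sub>0, \<dots>, \<kappa>\<^sub>n\<^sub>-\<^sub>1\<close>, the \<open>i\<close>-th one modulo a prime
  \<open>p\<^sub>i\<close>, which together determine the element and in which the multiplication is triangular:
  \<open>\<kappa>\<^sub>i(xy) = \<kappa>\<^sub>i(x) + \<kappa>\<^sub>i(y) + f\<^sub>i\<close>, where \<open>f\<^sub>i\<close> depends only on the coordinates of \<open>x\<close> and \<open>y\<close> with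
  index \<open>j < i\<close> (lemma \<open>exists_coordinates\<close>).

  If \<open>f\<^sub>i\<close> uses only coordinates with \<open>p\<^sub>j = p\<^sub>i\<close>, the loop is supernilpotent. A function on a power of
  the field with \<open>p\<^sub>i\<close> elements is a polynomial, so the \<open>i\<close>-th coordinate of a polynomial operation
  has a degree bounded independently of its arity: the bound for \<open>i\<close> comes from the
  fixed degree of \<open>f\<^sub>i\<close> and the bounds for \<open>j < i\<close>, and adding \<open>\<kappa>\<^sub>i(x) + \<kappa>\<^sub>i(y)\<close> does not raise
  it. A function of degree at most \<open>k\<close> has vanishing alternating sum over a cube of dimension
  \<open>k + 1\<close>, and this forces the implication in the term condition (lemma
  \<open>loop_coordinates.is_supernilpotent\<close>).

  It remains to find a term operation for which the coordinates of different primes do not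
  interact. This is done one coordinate at a time (lemma \<open>separate_one_prime\<close>). Suppose
  that it is achieved below \<open>r\<close> and let \<open>q = p\<^sub>r\<close>. Modulo the coordinates from \<open>r\<close> on, the loop is
  a product \<open>P \<times> Q\<close> of its \<open>q\<close>-part and its part prime to \<open>q\<close>, and a power map \<open>x \<mapsto> x\<^sup>k\<close> with a
  suitable exponent is the projection to \<open>Q\<close>. As \<open>q\<close> divides \<open>k\<close>, coordinate \<open>r\<close> of
  \<open>x\<^sup>k\<close> depends only on the lower coordinates of \<open>x\<close>, so that an idempotent iterate \<open>h\<close> of it has the following property: up to coordinate
  \<open>r\<close>, the value \<open>h(x)\<close> depends only on the \<open>Q\<close>-part of \<open>x\<close>. Up to coordinate \<open>r\<close>, every \<open>x\<close> is
  therefore uniquely \<open>a \<cdot> b\<close> with \<open>a = x/h(x)\<close> in the preimage of \<open>P\<close> and \<open>b = h(x)\<close> in a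
  transversal of \<open>Q\<close>. The operation
  \<open>x \<circ> y = ((x/h(x)) \<cdot> (y/h(y))) \<cdot> h(h(x) \<cdot> h(y))\<close> multiplies the two components separately. Its
  \<open>r\<close>-th coordinate, measured as \<open>\<kappa>\<^sub>r(x/h(x))\<close>, depends only on the \<open>q\<close>-part, while below \<open>r\<close>
  nothing changes. Above \<open>r\<close> the law stays triangular because \<open>k\<close> is \<open>0\<close> or \<open>1\<close> modulo each
  prime.
\<close>

section \<open>Loops in triangular coordinates modulo primes\<close>

text \<open>Coordinates are integers read modulo \<open>p i\<close>, so that they can be added and multiplied by integer
  constants without choosing residues.\<close>

definition agree :: "(nat \<Rightarrow> nat) \<Rightarrow> (nat \<Rightarrow> 'a \<Rightarrow> int) \<Rightarrow> nat set \<Rightarrow> 'a \<Rightarrow> 'a \<Rightarrow> bool" where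
  "agree p \<kappa> I x y \<longleftrightarrow> (\<forall>i\<in>I. [\<kappa> i x = \<kappa> i y] (mod int (p i)))"

lemma agree_refl [simp]: "agree p \<kappa> I x x"
  by (simp add: agree_def)

lemma agree_sym: "agree p \<kappa> I x y \<Longrightarrow> agree p \<kappa> I y x"
  by (simp add: agree_def cong_sym_eq)

lemma agree_trans: "agree p \<kappa> I x y \<Longrightarrow> agree p \<kappa> I y z \<Longrightarrow> agree p \<kappa> I x z"
  unfolding agree_def by (blast intro: cong_trans)

lemma agree_mono: "agree p \<kappa> J x y \<Longrightarrow> I \<subseteq> J \<Longrightarrow> agree p \<kappa> I x y"
  by (auto simp: agree_def)

lemma agree_Un: "agree p \<kappa> (I \<union> J) x y \<longleftrightarrow> agree p \<kappa> I x y \<and> agree p \<kappa> J x y"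
  by (auto simp: agree_def)

text \<open>This replaces the notion of a derived term: an operation is built from \<open>m\<close> if every set of
  functions closed under \<open>m\<close> is closed under it. In this form composing derivations needs no
  substitution of terms into terms.\<close>

definition pointwise_closed :: "('a \<Rightarrow> 'a \<Rightarrow> 'a) \<Rightarrow> ('b \<Rightarrow> 'a) set \<Rightarrow> bool" where
  "pointwise_closed m C \<longleftrightarrow> (\<forall>f\<in>C. \<forall>g\<in>C. (\<lambda>x. m (f x) (g x)) \<in> C)"

lemma pointwise_closedD:
  "pointwise_closed m C \<Longrightarrow> f \<in> C \<Longrightarrow> g \<in> C \<Longrightarrow> (\<lambda>x. m (f x) (g x)) \<in> C"
  by (simp add: pointwise_closed_def)

definition right_power :: "('a \<Rightarrow> 'a \<Rightarrow> 'a) \<Rightarrow> nat \<Rightarrow> 'a \<Rightarrow> 'a \<Rightarrow> 'a" where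
  "right_power m k x y = ((\<lambda>z. m z y) ^^ k) x"

lemma right_power_0 [simp]: "right_power m 0 x y = x"
  and right_power_Suc [simp]: "right_power m (Suc k) x y = m (right_power m k x y) y"
  by (simp_all add: right_power_def)

lemma right_power_add: "right_power m (j + k) x y = right_power m j (right_power m k x y) y"
  by (simp add: right_power_def funpow_add)

lemma pointwise_closed_right_power:
  assumes "pointwise_closed m C" "f \<in> C" "g \<in> C"
  shows "(\<lambda>x. right_power m k (f x) (g x)) \<in> C"
  using assms by (induction k) (auto simp: pointwise_closed_def)

text \<open>The assumption \<open>additive\<close> says that \<open>\<kappa> i (m x y) - \<kappa> i x - \<kappa> i y\<close> is a function of those coordinates
  of \<open>x\<close> and \<open>y\<close> that belong to \<open>dep i\<close>. Written with differences, it adds up along a composite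
  operation. Cancellation is a consequence, because the coordinates of a factor can be
  recovered one after the other.\<close>

locale loop_coordinates =
  fixes A :: "'a set" and m :: "'a \<Rightarrow> 'a \<Rightarrow> 'a" and e :: 'a
    and n :: nat and p :: "nat \<Rightarrow> nat" and \<kappa> :: "nat \<Rightarrow> 'a \<Rightarrow> int" and dep :: "nat \<Rightarrow> nat set"
  assumes finite: "finite A"
    and closed: "\<And>x y. x \<in> A \<Longrightarrow> y \<in> A \<Longrightarrow> m x y \<in> A"
    and unit_mem: "e \<in> A"
    and left_unit: "\<And>x. x \<in> A \<Longrightarrow> m e x = x"
    and right_unit: "\<And>x. x \<in> A \<Longrightarrow> m x e = x"
    and prime: "\<And>i. i < n \<Longrightarrow> prime (p i)"
    and dep: "\<And>i. i < n \<Longrightarrow> dep i \<subseteq> {..<i}"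
    and separate: "\<And>x y. x \<in> A \<Longrightarrow> y \<in> A \<Longrightarrow> agree p \<kappa> {..<n} x y \<Longrightarrow> x = y"
    and additive: "\<And>i x x' y y'. i < n \<Longrightarrow> x \<in> A \<Longrightarrow> x' \<in> A \<Longrightarrow> y \<in> A \<Longrightarrow> y' \<in> A \<Longrightarrow>
          agree p \<kappa> (dep i) x x' \<Longrightarrow> agree p \<kappa> (dep i) y y' \<Longrightarrow>
          [\<kappa> i (m x y) - \<kappa> i (m x' y') = (\<kappa> i x - \<kappa> i x') + (\<kappa> i y - \<kappa> i y')] (mod int (p i))"
begin

abbreviation agr :: "nat set \<Rightarrow> 'a \<Rightarrow> 'a \<Rightarrow> bool" where
  "agr \<equiv> agree p \<kappa>"

text \<open>Agreement on a set of coordinates is a congruence of the loop if the set contains everything that its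
  members depend on.\<close>

definition dep_closed :: "nat set \<Rightarrow> bool" where
  "dep_closed I \<longleftrightarrow> I \<subseteq> {..<n} \<and> (\<forall>i\<in>I. dep i \<subseteq> I)"

lemma dep_closed_lessThan: "i \<le> n \<Longrightarrow> dep_closed {..<i}"
  unfolding dep_closed_def by (meson dep lessThan_iff lessThan_subset_iff less_imp_le order_trans less_le_trans)

lemma opposite: "loop_coordinates A (\<lambda>x y. m y x) e n p \<kappa> dep"
proof
  fix i x x' y y'
  assume "i < n" "x \<in> A" "x' \<in> A" "y \<in> A" "y' \<in> A" "agr (dep i) x x'" "agr (dep i) y y'"
  then show "[\<kappa> i (m y x) - \<kappa> i (m y' x') = (\<kappa> i x - \<kappa> i x') + (\<kappa> i y - \<kappa> i y')] (mod int (p i))"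
    using additive[of i y y' x x'] by (simp add: add.commute)
qed (simp_all add: finite closed unit_mem left_unit right_unit prime dep separate)

lemma right_power_closed: "x \<in> A \<Longrightarrow> y \<in> A \<Longrightarrow> right_power m k x y \<in> A"
  by (induction k) (auto intro: closed)

lemma agree_mult:
  assumes "dep_closed I" "x \<in> A" "x' \<in> A" "y \<in> A" "y' \<in> A" "agr I x x'" "agr I y y'"
  shows "agr I (m x y) (m x' y')"
  unfolding agree_def
proof
  fix i assume i: "i \<in> I"
  then have "i < n" "dep i \<subseteq> I"
    using assms(1) by (auto simp: dep_closed_def)
  then have "[\<kappa> i (m x y) - \<kappa> i (m x' y') = (\<kappa> i x - \<kappa> i x') + (\<kappa> i y - \<kappa> i y')] (mod int (p i))"
    using assms by (intro additive) (blast intro: agree_mono)+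
  moreover have "[(\<kappa> i x - \<kappa> i x') + (\<kappa> i y - \<kappa> i y') = 0 + 0] (mod int (p i))"
    using assms(6,7) i unfolding agree_def by (intro cong_add) (simp_all add: cong_diff_iff_cong_0)
  ultimately show "[\<kappa> i (m x y) = \<kappa> i (m x' y')] (mod int (p i))"
    by (metis add_0 cong_diff_iff_cong_0 cong_trans)
qed

lemma agree_right_power:
  assumes "dep_closed I" "x \<in> A" "x' \<in> A" "y \<in> A" "y' \<in> A" "agr I x x'" "agr I y y'"
  shows "agr I (right_power m k x y) (right_power m k x' y')"
  by (induction k) (use assms in \<open>simp_all add: agree_mult right_power_closed\<close>)

lemma right_power_diff:
  assumes "dep_closed I" "dep i \<subseteq> I" "i < n" "x \<in> A" "x' \<in> A" "y \<in> A" "y' \<in> A" "agr I x x'" "agr I y y'"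
  shows "[\<kappa> i (right_power m k x y) - \<kappa> i (right_power m k x' y')
          = (\<kappa> i x - \<kappa> i x') + int k * (\<kappa> i y - \<kappa> i y')] (mod int (p i))"
proof (induction k)
  case (Suc k)
  let ?u = "right_power m k x y" and ?u' = "right_power m k x' y'"
  have "[\<kappa> i (m ?u y) - \<kappa> i (m ?u' y') = (\<kappa> i ?u - \<kappa> i ?u') + (\<kappa> i y - \<kappa> i y')] (mod int (p i))"
    using assms agree_mono[OF agree_right_power[OF assms(1,4-9)] assms(2)]
    by (intro additive right_power_closed) (simp_all add: agree_mono[OF _ assms(2)])
  also have "[(\<kappa> i ?u - \<kappa> i ?u') + (\<kappa> i y - \<kappa> i y') =
      ((\<kappa> i x - \<kappa> i x') + int k * (\<kappa> i y - \<kappa> i y')) + (\<kappa> i y - \<kappa> i y')] (mod int (p i))"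
    using Suc by (rule cong_add) simp
  finally show ?case
    by (simp add: algebra_simps)
qed simp

lemma right_cancel:
  assumes I: "dep_closed I" and A: "x \<in> A" "x' \<in> A" "y \<in> A" "y' \<in> A"
    and xy: "agr I (m x y) (m x' y')" and y: "agr I y y'"
  shows "agr I x x'"
proof -
  have "i \<in> I \<longrightarrow> [\<kappa> i x = \<kappa> i x'] (mod int (p i))" for i
  proof (induction i rule: less_induct)
    case (less i)
    show ?case
    proof
      assume i: "i \<in> I"
      then have d: "i < n" "dep i \<subseteq> I" "dep i \<subseteq> {..<i}"
        using I dep by (auto simp: dep_closed_def)
      have "agr (dep i) x x'"
        unfolding agree_def using less d by blast
      moreover have "agr (dep i) y y'"
        using y d(2) by (rule agree_mono)
      ultimately have "[\<kappa> i (m x y) - \<kappa> i (m x' y') = (\<kappa> i x - \<kappa> i x') + (\<kappa> i y - \<kappa> i y')] (mod int (p i))"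
        using A d by (intro additive) simp_all
      moreover have "[\<kappa> i (m x y) - \<kappa> i (m x' y') = 0] (mod int (p i))"
        "[\<kappa> i y - \<kappa> i y' = 0] (mod int (p i))"
        using xy y i by (auto simp: agree_def cong_diff_iff_cong_0)
      ultimately have "[\<kappa> i x - \<kappa> i x' = 0] (mod int (p i))"
        using diff_zero by (metis add.right_neutral cong_add_lcancel cong_sym cong_trans)
      then show "[\<kappa> i x = \<kappa> i x'] (mod int (p i))"
        by (simp add: cong_diff_iff_cong_0)
    qed
  qed
  then show ?thesis
    by (simp add: agree_def)
qed

text \<open>Induction on the coordinates in increasing order. If the coordinates below \<open>b\<close> have period \<open>W\<close>
  under right multiplication by \<open>y\<close>, then \<open>W\<close> multiplications change coordinate \<open>b\<close> by an amount that
  is the same from every point of the sequence, so that \<open>p b\<close> rounds bring it back.\<close>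

lemma right_power_period:
  assumes I: "dep_closed I" and A: "x \<in> A" "y \<in> A" and k: "(\<Prod>i\<in>I. p i) dvd k"
  shows "agr I (right_power m k x y) x"
proof -
  have base: "dep_closed I \<longrightarrow> (\<forall>x\<in>A. agr I (right_power m (\<Prod>i\<in>I. p i) x y) x)"
    if "finite I" for I
    using that
  proof (induction I rule: finite_linorder_max_induct)
    case empty
    then show ?case by (simp add: agree_def)
  next
    case (insert b I)
    show ?case
    proof (intro impI ballI)
      fix x assume cl: "dep_closed (insert b I)" and x: "x \<in> A"
      have b: "b < n" "dep b \<subseteq> I" and clI: "dep_closed I"
        using cl dep insert(2) by (fastforce simp: dep_closed_def)+
      define W where "W = (\<Prod>i\<in>I. p i)"
      have ih: "agr I (right_power m W z y) z" if "z \<in> A" for z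
        using insert.IH clI that by (simp add: W_def)
      define u where "u j = right_power m (j * W) x y" for j
      have uA: "u j \<in> A" for j
        using x A by (simp add: u_def right_power_closed)
      have uS: "u (Suc j) = right_power m W (u j) y" for j
        by (simp add: u_def right_power_add)
      have ux: "agr I (u j) x" for j
      proof (induction j)
        case (Suc j)
        then show ?case
          unfolding uS by (rule agree_trans[OF ih[OF uA]])
      qed (simp add: u_def)
      have step: "[\<kappa> b (u j) - \<kappa> b x = int j * (\<kappa> b (u 1) - \<kappa> b x)] (mod int (p b))" for j
      proof (induction j)
        case (Suc j)
        have "[\<kappa> b (u (Suc j)) - \<kappa> b (u 1) = \<kappa> b (u j) - \<kappa> b x] (mod int (p b))"
          using right_power_diff[OF clI b(2,1) uA[of j] x A(2) A(2) ux[of j] agree_refl, of W]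
          by (simp add: uS) (simp add: u_def)
        also note Suc
        finally have "[(\<kappa> b (u (Suc j)) - \<kappa> b (u 1)) + (\<kappa> b (u 1) - \<kappa> b x)
            = int j * (\<kappa> b (u 1) - \<kappa> b x) + (\<kappa> b (u 1) - \<kappa> b x)] (mod int (p b))"
          by (rule cong_add) simp
        then show ?case
          by (simp add: algebra_simps)
      qed (simp add: u_def)
      have "[\<kappa> b (u (p b)) - \<kappa> b x = 0] (mod int (p b))"
        by (rule cong_trans[OF step]) (simp add: cong_0_iff)
      then have "agr (insert b I) (u (p b)) x"
        using ux[of "p b"] by (simp add: agree_def cong_diff_iff_cong_0)
      moreover have "(\<Prod>i\<in>insert b I. p i) = p b * W"
        using insert by (auto simp: W_def)
      ultimately show "agr (insert b I) (right_power m (\<Prod>i\<in>insert b I. p i) x y) x"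
        by (simp add: u_def)
    qed
  qed
  have "finite I"
    using I finite_subset by (auto simp: dep_closed_def)
  then have base: "agr I (right_power m (\<Prod>i\<in>I. p i) x y) x" if "x \<in> A" for x
    using base I that by simp
  obtain t where "k = t * (\<Prod>i\<in>I. p i)"
    using k by (metis dvdE mult.commute)
  moreover have "agr I (right_power m (t * (\<Prod>i\<in>I. p i)) x y) x" for t
  proof (induction t)
    case (Suc t)
    have "agr I (right_power m (Suc t * (\<Prod>i\<in>I. p i)) x y) (right_power m (t * (\<Prod>i\<in>I. p i)) x y)"
      using base[OF right_power_closed[OF A]] by (simp add: right_power_add)
    then show ?case
      using Suc by (rule agree_trans)
  qed simp
  ultimately show ?thesis
    by simp
qed

text \<open>As right multiplication by \<open>y\<close> has finite order, division is a power of it and hence a term.\<close>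

definition right_div :: "'a \<Rightarrow> 'a \<Rightarrow> 'a" where
  "right_div x y = right_power m ((\<Prod>i<n. p i) - 1) x y"

lemma right_div_closed: "x \<in> A \<Longrightarrow> y \<in> A \<Longrightarrow> right_div x y \<in> A"
  by (simp add: right_div_def right_power_closed)

lemma mult_right_div:
  assumes "x \<in> A" "y \<in> A"
  shows "m (right_div x y) y = x"
proof -
  have "Suc ((\<Prod>i<n. p i) - 1) = (\<Prod>i<n. p i)"
    using prime prime_gt_0_nat by (simp add: prod_pos)
  then have "m (right_div x y) y = right_power m (\<Prod>i<n. p i) x y"
    unfolding right_div_def by (metis right_power_Suc)
  moreover have "agr {..<n} (right_power m (\<Prod>i<n. p i) x y) x"
    using right_power_period[OF dep_closed_lessThan[OF le_refl] assms dvd_refl] .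
  ultimately show ?thesis
    using separate assms right_power_closed by metis
qed

lemma agree_right_div:
  assumes "dep_closed I" "x \<in> A" "x' \<in> A" "y \<in> A" "y' \<in> A" "agr I x x'" "agr I y y'"
  shows "agr I (right_div x y) (right_div x' y')"
  unfolding right_div_def using assms by (rule agree_right_power)

lemma right_division_unique:
  assumes "a \<in> A" "b \<in> A"
  shows "\<exists>!y. y \<in> A \<and> m y a = b"
proof (rule ex1I[of _ "right_div b a"])
  fix y assume "y \<in> A \<and> m y a = b"
  then have "agr {..<n} y (right_div b a)"
    using right_cancel[OF dep_closed_lessThan[of n], of y "right_div b a" a a] assms
    by (simp add: right_div_closed mult_right_div)
  then show "y = right_div b a"
    using \<open>y \<in> A \<and> m y a = b\<close> assms separate right_div_closed by blast
qed (use assms in \<open>simp add: right_div_closed mult_right_div\<close>)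

lemma is_loop: "is_loop A m"
proof -
  interpret op: loop_coordinates A "\<lambda>x y. m y x" e n p \<kappa> dep
    by (rule opposite)
  show ?thesis
    unfolding is_loop_def
  proof (intro conjI ballI bexI[OF _ unit_mem])
    show "\<exists>!x. x \<in> A \<and> m a x = b" "\<exists>!y. y \<in> A \<and> m y a = b" if "a \<in> A" "b \<in> A" for a b
      using that by (rule op.right_division_unique right_division_unique)+
  qed (simp_all add: closed left_unit right_unit)
qed

end

section \<open>Removing the interaction between different primes\<close>

text \<open>The sequence of iterates is eventually periodic, and an iterate beyond the preperiod whose index is a
  multiple of the period is idempotent.\<close>

lemma idempotent_iterate:
  assumes "finite A" "f ` A \<subseteq> A"
  obtains N where "N > 0" "\<And>x. x \<in> A \<Longrightarrow> (f ^^ N) ((f ^^ N) x) = (f ^^ N) x"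
proof -
  have fA: "(f ^^ i) x \<in> A" if "x \<in> A" for i x
    using assms(2) that by (induction i) auto
  have "range (\<lambda>i. restrict (f ^^ i) A) \<subseteq> A \<rightarrow>\<^sub>E A"
    using fA by auto
  then have "finite (range (\<lambda>i. restrict (f ^^ i) A))"
    by (rule finite_subset) (simp add: finite_PiE assms(1))
  then have "\<not> inj (\<lambda>i. restrict (f ^^ i) A)"
    using finite_imageD[of "\<lambda>i. restrict (f ^^ i) A" UNIV] by auto
  then obtain i j where "i \<noteq> j" "restrict (f ^^ i) A = restrict (f ^^ j) A"
    by (meson injI)
  then obtain i j where ij: "i < j" "restrict (f ^^ i) A = restrict (f ^^ j) A"
    by (cases "i < j") (auto simp: not_less dest: le_neq_trans)
  define d where "d = j - i"
  have d: "d > 0" "j = d + i"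
    using ij by (auto simp: d_def)
  have shift: "(f ^^ (d + s)) x = (f ^^ s) x" if "x \<in> A" "s \<ge> i" for s x
  proof -
    have "(f ^^ (s - i)) ((f ^^ j) x) = (f ^^ (s - i)) ((f ^^ i) x)"
      using fun_cong[OF ij(2), of x] that by simp
    moreover have "s - i + j = d + s" "s - i + i = s"
      using that d by auto
    ultimately show ?thesis
      using funpow_add[of "s - i" j f] funpow_add[of "s - i" i f] by simp
  qed
  have shifts: "(f ^^ (d * t + s)) x = (f ^^ s) x" if "x \<in> A" "s \<ge> i" for s t x
  proof (induction t)
    case (Suc t)
    then show ?case
      using shift[OF that(1), of "d * t + s"] that by (simp add: add.assoc)
  qed simp
  have "i \<le> d * Suc i"
    using d mult_le_mono1[of 1 d "Suc i"] by simp
  then have "(f ^^ (d * Suc i)) ((f ^^ (d * Suc i)) x) = (f ^^ (d * Suc i)) x" if "x \<in> A" for x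
    using shifts[OF that, of "d * Suc i" "Suc i"] by (simp add: funpow_add)
  then show thesis
    using that[of "d * Suc i"] d by simp
qed

context loop_coordinates
begin

text \<open>The power map with exponent \<open>k\<close> is trivial on the coordinates \<open>I\<close> of the prime \<open>q\<close> if \<open>k\<close> is a
  multiple of their period, and the identity on \<open>J\<close> if \<open>k\<close> is \<open>1\<close> modulo the period of \<open>J\<close>. Both are
  possible because these periods are coprime. An iterate of the power map has the same
  properties and is idempotent; its linear coefficient \<open>c\<close> is a power of \<open>k\<close>.\<close>

lemma idempotent_projection:
  fixes q :: nat
  assumes q: "prime q"
    and I: "dep_closed I" "\<And>i. i \<in> I \<Longrightarrow> p i = q"
    and J: "dep_closed J" "\<And>i. i \<in> J \<Longrightarrow> p i \<noteq> q"
  obtains h c where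
    "\<And>x. x \<in> A \<Longrightarrow> h x \<in> A" "\<And>x. x \<in> A \<Longrightarrow> h (h x) = h x" "h e = e"
    "\<And>x. x \<in> A \<Longrightarrow> agr I (h x) e" "\<And>x. x \<in> A \<Longrightarrow> agr J (h x) x"
    "[c = 0] (mod int q)" "\<And>i. i < n \<Longrightarrow> p i \<noteq> q \<Longrightarrow> [c = 1] (mod int (p i))"
    "\<And>i x x'. i < n \<Longrightarrow> x \<in> A \<Longrightarrow> x' \<in> A \<Longrightarrow> agr {..<i} x x' \<Longrightarrow>
        [\<kappa> i (h x) - \<kappa> i (h x') = c * (\<kappa> i x - \<kappa> i x')] (mod int (p i))"
    "\<And>C f. pointwise_closed m C \<Longrightarrow> f \<in> C \<Longrightarrow> (\<lambda>x :: 'b. h (f x)) \<in> C"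
proof -
  \<comment> \<open>The factor \<open>q\<close> ensures that \<open>q\<close> divides the exponent even if \<open>I\<close> is empty.\<close>
  define V where "V = q * (\<Prod>i\<in>I. p i)"
  \<comment> \<open>All primes other than \<open>q\<close>, not only those of \<open>J\<close>: the coefficient \<open>c\<close> has to be \<open>1\<close>
    modulo each of them.\<close>
  define W where "W = (\<Prod>i\<in>{i. i < n \<and> p i \<noteq> q}. p i)"
  have In: "i < n" if "i \<in> I \<union> J" for i
    using that I(1) J(1) by (auto simp: dep_closed_def)
  have "coprime q W"
    unfolding W_def using q prime by (intro prod_coprime_right) (auto simp: primes_coprime)
  then have "coprime V W"
    unfolding V_def using I(2) by (simp add: prod_coprime_left)
  then obtain t where t: "[V * t = 1] (mod W)"
    using cong_solve_coprime_nat by (metis One_nat_def)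
  \<comment> \<open>Adding \<open>W\<close> keeps the congruence and makes \<open>k\<close> positive, which matters if \<open>W = 1\<close>.\<close>
  define k where "k = V * (t + W)"
  have kW: "[k = 1] (mod W)"
    using t by (simp add: k_def cong_def distrib_left)
  have "V > 0" "W > 0"
    using q prime In by (auto simp: V_def W_def prime_gt_0_nat intro!: prod_pos)
  then have k0: "k > 0"
    by (simp add: k_def)
  have Wk: "W dvd k - 1"
    using kW k0 by (simp add: cong_altdef_nat)
  \<comment> \<open>Starting from \<open>x\<close> rather than from \<open>e\<close> avoids the constant \<open>e\<close>, so that this is visibly a
    term.\<close>
  define h0 where "h0 x = right_power m (k - 1) x x" for x
  have h0: "h0 x = right_power m k e x" if "x \<in> A" for x
    using right_power_add[of m "k - 1" 1 e x] k0 that left_unit by (simp add: h0_def)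
  have h0A: "h0 x \<in> A" if "x \<in> A" for x
    using that by (simp add: h0_def right_power_closed)
  have h0I: "agr I (h0 x) e" if "x \<in> A" for x
    using right_power_period[OF I(1) unit_mem that, of k] by (simp add: h0 that k_def V_def)
  have "(\<Prod>i\<in>J. p i) dvd W"
    unfolding W_def using J(2) In by (intro prod_dvd_prod_subset) auto
  then have h0J: "agr J (h0 x) x" if "x \<in> A" for x
    using right_power_period[OF J(1) that that] Wk dvd_trans unfolding h0_def by blast
  have h0lin: "[\<kappa> i (h0 x) - \<kappa> i (h0 x') = int k * (\<kappa> i x - \<kappa> i x')] (mod int (p i))"
    and h0agr: "agr {..<i} (h0 x) (h0 x')"
    if "i < n" "x \<in> A" "x' \<in> A" "agr {..<i} x x'" for i x x'
  proof -
    show "[\<kappa> i (h0 x) - \<kappa> i (h0 x') = int k * (\<kappa> i x - \<kappa> i x')] (mod int (p i))"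
      using right_power_diff[OF dep_closed_lessThan dep that(1) unit_mem unit_mem that(2,3) agree_refl that(4), of k]
        that by (simp add: h0)
    show "agr {..<i} (h0 x) (h0 x')"
      unfolding h0_def using that by (intro agree_right_power dep_closed_lessThan) auto
  qed
  have h0e: "h0 e = e"
  proof -
    have "right_power m j e e = e" for j
      by (induction j) (auto simp: unit_mem left_unit)
    then show ?thesis by (simp add: h0_def)
  qed
  have h0C: "(\<lambda>x :: 'b. h0 (f x)) \<in> C" if "pointwise_closed m C" "f \<in> C" for C f
    using that unfolding h0_def by (intro pointwise_closed_right_power)
  obtain N where N: "N > 0" "\<And>x. x \<in> A \<Longrightarrow> (h0 ^^ N) ((h0 ^^ N) x) = (h0 ^^ N) x"
    using idempotent_iterate[OF finite, of h0] h0A by blast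
  define h where "h = h0 ^^ N"
  have itA: "(h0 ^^ j) x \<in> A" if "x \<in> A" for j x
    using that h0A by (induction j) auto
  have hI: "agr I (h x) e" if "x \<in> A" for x
    using h0I[OF itA[OF that, of "N - 1"]] N by (cases N) (simp_all add: h_def)
  have hJ: "agr J ((h0 ^^ j) x) x" if "x \<in> A" for j x
  proof (induction j)
    case (Suc j)
    show ?case
      using agree_trans[OF h0J[OF itA[OF that, of j]] Suc] by simp
  qed simp
  have hlin: "[\<kappa> i ((h0 ^^ j) x) - \<kappa> i ((h0 ^^ j) x') = int k ^ j * (\<kappa> i x - \<kappa> i x')] (mod int (p i))
      \<and> agr {..<i} ((h0 ^^ j) x) ((h0 ^^ j) x')"
    if "i < n" "x \<in> A" "x' \<in> A" "agr {..<i} x x'" for i x x' j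
  proof (induction j)
    case (Suc j)
    let ?u = "(h0 ^^ j) x" and ?u' = "(h0 ^^ j) x'"
    have "[\<kappa> i (h0 ?u) - \<kappa> i (h0 ?u') = int k * (\<kappa> i ?u - \<kappa> i ?u')] (mod int (p i))"
      using Suc that by (intro h0lin itA) auto
    also have "[int k * (\<kappa> i ?u - \<kappa> i ?u') = int k * (int k ^ j * (\<kappa> i x - \<kappa> i x'))] (mod int (p i))"
      using Suc by (intro cong_mult) auto
    finally have "[\<kappa> i (h0 ?u) - \<kappa> i (h0 ?u') = int k ^ Suc j * (\<kappa> i x - \<kappa> i x')] (mod int (p i))"
      by (simp add: mult.assoc)
    moreover have "agr {..<i} (h0 ?u) (h0 ?u')"
      using Suc that by (intro h0agr itA) auto
    ultimately show ?case by simp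
  qed (use that in simp)
  have hC: "(\<lambda>x :: 'b. (h0 ^^ j) (f x)) \<in> C" if "pointwise_closed m C" "f \<in> C" for C f j
  proof (induction j)
    case (Suc j)
    then show ?case using h0C[OF that(1)] by simp
  qed (use that in simp)
  show thesis
  proof (rule that[of h "int (k ^ N)"])
    show "h e = e"
      unfolding h_def using h0e by (induction N) auto
    have "q dvd k"
      by (simp add: k_def V_def)
    then have "int q dvd int (k ^ N)"
      unfolding int_dvd_int_iff using N by (meson dvd_power dvd_trans)
    then show "[int (k ^ N) = 0] (mod int q)"
      by (simp add: cong_0_iff)
    show "[int (k ^ N) = 1] (mod int (p i))" if "i < n" "p i \<noteq> q" for i
    proof -
      have "p i dvd W"
        unfolding W_def using that by (intro dvd_prodI) auto
      then have "[k = 1] (mod p i)"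
        using kW cong_dvd_modulus_nat by blast
      then have "[k ^ N = 1 ^ N] (mod p i)"
        by (rule cong_pow)
      then show ?thesis
        by (metis cong_int_iff of_nat_1 power_one)
    qed
    show "h x \<in> A" "h (h x) = h x" "agr I (h x) e" "agr J (h x) x" if "x \<in> A" for x
      using itA[OF that] N(2)[OF that] hI[OF that] hJ[OF that] by (simp_all add: h_def)
    show "[\<kappa> i (h x) - \<kappa> i (h x') = int (k ^ N) * (\<kappa> i x - \<kappa> i x')] (mod int (p i))"
      if "i < n" "x \<in> A" "x' \<in> A" "agr {..<i} x x'" for i x x'
      using hlin[OF that, of N] by (simp add: h_def)
    show "(\<lambda>x :: 'b. h (f x)) \<in> C" if "pointwise_closed m C" "f \<in> C" for C f
      using hC[OF that] by (simp add: h_def)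
  qed
qed

end

text \<open>The linear bookkeeping for a coordinate above the one being separated: \<open>x\<close> and \<open>y\<close> stand for
  differences of that coordinate, \<open>a\<close> and \<open>b\<close> for those of \<open>x/h(x)\<close> and \<open>y/h(y)\<close>, \<open>h\<close> and \<open>g\<close> for those
  of \<open>h(x)\<close> and \<open>h(y)\<close>. The total coefficient \<open>(1 - c) + c\<^sup>2\<close> is \<open>1\<close> because \<open>c\<close> is idempotent.\<close>

lemma cong_recombine:
  fixes c :: int
  assumes x: "[x = a + h] (mod q)" "[h = c * x] (mod q)"
    and y: "[y = b + g] (mod q)" "[g = c * y] (mod q)"
    and st: "[s = a + b] (mod q)" "[t = h + g] (mod q)" "[u = c * t] (mod q)" "[z = s + u] (mod q)"
    and c: "[c * c = c] (mod q)"
  shows "[z = x + y] (mod q)"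
proof -
  have a: "[a = x - c * x] (mod q)"
    using cong_diff[OF cong_sym[OF x(1)] x(2)] by simp
  have b: "[b = y - c * y] (mod q)"
    using cong_diff[OF cong_sym[OF y(1)] y(2)] by simp
  have "[t = c * x + c * y] (mod q)"
    using cong_trans[OF st(2) cong_add[OF x(2) y(2)]] .
  then have "[c * t = c * (c * x + c * y)] (mod q)"
    by (rule cong_mult[OF cong_refl])
  then have "[u = (c * c) * (x + y)] (mod q)"
    using cong_trans[OF st(3)] by (simp add: algebra_simps)
  also have "[(c * c) * (x + y) = c * (x + y)] (mod q)"
    by (rule cong_mult[OF c cong_refl])
  finally have u: "[u = c * (x + y)] (mod q)" .
  have "[z = ((x - c * x) + (y - c * y)) + c * (x + y)] (mod q)"
    using cong_trans[OF st(4) cong_add[OF cong_trans[OF st(1) cong_add[OF a b]] u]] .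
  then show ?thesis
    by (simp add: algebra_simps)
qed

context loop_coordinates
begin

text \<open>The set \<open>I\<close> of coordinates describes the factor \<open>P\<close> and \<open>J\<close> the factor \<open>Q\<close> of the quotient by the
  coordinates from \<open>r\<close> on. Every \<open>x\<close> is the product of \<open>a x\<close>, which is trivial on \<open>J\<close>, and \<open>h x\<close>,
  which is trivial on \<open>I\<close>; the new operation multiplies these components separately and corrects the
  second product by \<open>h\<close> so that it lies in the transversal again. The new coordinate \<open>r\<close> is
  the old one of the first component.\<close>

lemma separate_one_prime:
  assumes r: "r < n" and deps: "\<And>i. dep i = {j. j < i \<and> (i < r \<longrightarrow> p j = p i)}"
  obtains circ \<kappa>' where
    "loop_coordinates A circ e n p \<kappa>' (\<lambda>i. {j. j < i \<and> (i < Suc r \<longrightarrow> p j = p i)})"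
    "\<And>C :: ('b \<Rightarrow> 'a) set. pointwise_closed m C \<Longrightarrow> pointwise_closed circ C"
proof -
  define I where "I = {i. i < r \<and> p i = p r}"
  define J where "J = {i. i < r \<and> p i \<noteq> p r}"
  have I: "dep_closed I" and J: "dep_closed J"
    using r by (auto simp: dep_closed_def I_def J_def deps)
  have IJ: "{..<r} = I \<union> J"
    by (auto simp: I_def J_def)
  have q: "prime (p r)"
    using prime r .
  obtain h c where hA: "\<And>x. x \<in> A \<Longrightarrow> h x \<in> A" and hh: "\<And>x. x \<in> A \<Longrightarrow> h (h x) = h x" and he: "h e = e"
    and hI: "\<And>x. x \<in> A \<Longrightarrow> agr I (h x) e" and hJ: "\<And>x. x \<in> A \<Longrightarrow> agr J (h x) x"
    and c: "[c = 0] (mod int (p r))" "\<And>i. i < n \<Longrightarrow> p i \<noteq> p r \<Longrightarrow> [c = 1] (mod int (p i))"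
    and hlin: "\<And>i x x'. i < n \<Longrightarrow> x \<in> A \<Longrightarrow> x' \<in> A \<Longrightarrow> agr {..<i} x x' \<Longrightarrow>
        [\<kappa> i (h x) - \<kappa> i (h x') = c * (\<kappa> i x - \<kappa> i x')] (mod int (p i))"
    and hC: "\<And>C f. pointwise_closed m C \<Longrightarrow> f \<in> C \<Longrightarrow> (\<lambda>x :: 'b. h (f x)) \<in> C"
    by (rule idempotent_projection[OF q I _ J]) (auto simp: I_def J_def)
  define a where "a x = right_div x (h x)" for x
  define circ where "circ x y = m (m (a x) (a y)) (h (m (h x) (h y)))" for x y
  define \<kappa>' where "\<kappa>' i x = \<kappa> i (if i = r then a x else x)" for i x
  have aA: "a x \<in> A" if "x \<in> A" for x
    using that by (simp add: a_def right_div_closed hA)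
  have split: "m (a x) (h x) = x" if "x \<in> A" for x
    using that by (simp add: a_def mult_right_div hA)
  note mem = closed hA aA unit_mem
  have circA: "circ x y \<in> A" if "x \<in> A" "y \<in> A" for x y
    using that by (simp add: circ_def mem)
  have Sr: "dep_closed {..<Suc r}"
    using r by (intro dep_closed_lessThan) simp
  have aI: "agr I (a x) x" if "x \<in> A" for x
    using agree_mult[OF I, of "a x" "a x" "h x" e] split[OF that] hI[OF that]
    by (simp add: that mem right_unit agree_sym)
  have aJ: "agr J (a x) e" if "x \<in> A" for x
    using right_cancel[OF J, of "a x" e "h x" "h x"] split[OF that] hJ[OF that]
    by (simp add: that mem left_unit agree_sym)
  \<comment> \<open>Coordinate \<open>r\<close> of \<open>h x = h (h x)\<close> depends only on the lower coordinates of \<open>h x\<close>, since its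
    linear coefficient \<open>c\<close> vanishes modulo \<open>p r\<close>; and those are determined by \<open>J\<close>.\<close>
  have h_det: "agr {..<Suc r} (h x) (h x')" if "x \<in> A" "x' \<in> A" "agr J x x'" for x x'
  proof -
    have "agr J (h x) (h x')"
      using agree_trans[OF agree_trans[OF hJ that(3)] agree_sym[OF hJ]] that(1,2) .
    moreover have "agr I (h x) (h x')"
      using agree_trans[OF hI agree_sym[OF hI]] that(1,2) .
    ultimately have lt: "agr {..<r} (h x) (h x')"
      by (simp add: IJ agree_Un)
    have "[\<kappa> r (h x) - \<kappa> r (h x') = c * (\<kappa> r (h x) - \<kappa> r (h x'))] (mod int (p r))"
      using hlin[OF r hA hA lt] that by (simp add: hh)
    moreover have "[c * (\<kappa> r (h x) - \<kappa> r (h x')) = 0 * (\<kappa> r (h x) - \<kappa> r (h x'))] (mod int (p r))"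
      by (rule cong_mult[OF c(1) cong_refl])
    ultimately have "[\<kappa> r (h x) - \<kappa> r (h x') = 0] (mod int (p r))"
      using cong_trans by fastforce
    then show ?thesis
      using lt by (simp add: agree_def lessThan_Suc cong_diff_iff_cong_0)
  qed
  have hb: "agr J (h (m (h x) (h y))) (m x y)" if "x \<in> A" "y \<in> A" for x y
    using agree_trans[OF hJ agree_mult[OF J _ _ _ _ hJ hJ]] that by (simp add: mem)
  have circ_lt: "agr {..<r} (circ x y) (m x y)" if xy: "x \<in> A" "y \<in> A" for x y
  proof -
    have "agr I (h (m (h x) (h y))) e"
      using xy by (simp add: hI mem)
    then have "agr I (circ x y) (m (m x y) e)"
      unfolding circ_def using xy by (intro agree_mult I) (simp_all add: mem aI)
    moreover have "agr J (circ x y) (m (m e e) (m x y))"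
      unfolding circ_def using xy by (intro agree_mult J) (simp_all add: mem aJ hb)
    ultimately show ?thesis
      using xy by (simp add: IJ agree_Un mem left_unit right_unit)
  qed
  \<comment> \<open>Up to coordinate \<open>r\<close>, the second component of \<open>circ x y\<close> is the correction factor, which can be
    cancelled.\<close>
  have a_circ: "agr {..<Suc r} (a (circ x y)) (m (a x) (a y))" if xy: "x \<in> A" "y \<in> A" for x y
  proof -
    let ?q = "h (m (h x) (h y))"
    have "agr J (circ x y) (m x y)"
      using circ_lt[OF xy] by (simp add: IJ agree_Un)
    then have "agr J (circ x y) ?q"
      using agree_trans agree_sym hb xy by metis
    then have "agr {..<Suc r} (h (circ x y)) ?q"
      using h_det[of "circ x y" ?q] xy by (simp add: hh mem circA)
    moreover have "m (a (circ x y)) (h (circ x y)) = m (m (a x) (a y)) ?q"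
      using xy split[OF circA] by (simp add: circ_def)
    ultimately show ?thesis
      using right_cancel[OF Sr, of "a (circ x y)" "m (a x) (a y)" "h (circ x y)" ?q] xy
      by (simp add: mem circA)
  qed
  have old_lt: "agree p \<kappa>' D x x' \<longleftrightarrow> agr D x x'" if "r \<notin> D" for D x x'
    using that by (auto simp: agree_def \<kappa>'_def)
  \<comment> \<open>The new coordinates separate at least as much as the old ones: the only changed coordinate can be
    recovered from \<open>x = (a x)(h x)\<close>, as \<open>h x\<close> is determined by lower coordinates.\<close>
  have old: "agr {..<i} x x'" if "i \<le> n" "x \<in> A" "x' \<in> A" "agree p \<kappa>' {..<i} x x'" for i x x'
  proof (cases "r < i")
    case False
    then show ?thesis using that old_lt[of "{..<i}"] by simp
  next
    case True
    have rest: "agr ({..<i} - {r}) x x'"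
      using agree_mono[OF that(4), of "{..<i} - {r}"] old_lt[of "{..<i} - {r}"] by simp
    then have lt: "agr {..<r} x x'"
      using True by (auto elim!: agree_mono)
    then have hx: "agr {..<Suc r} (h x) (h x')"
      using h_det[OF that(2,3)] by (simp add: IJ agree_Un)
    have "agr {..<r} (h x) (h x')"
      using hx by (rule agree_mono) simp
    then have "agr {..<r} (a x) (a x')"
      unfolding a_def using that lt r by (intro agree_right_div dep_closed_lessThan) (simp_all add: hA)
    moreover have "[\<kappa> r (a x) = \<kappa> r (a x')] (mod int (p r))"
      using bspec[OF that(4)[unfolded agree_def], of r] True by (simp add: \<kappa>'_def)
    ultimately have "agr {..<Suc r} (a x) (a x')"
      by (simp add: agree_def lessThan_Suc)
    then have "agr {..<Suc r} x x'"
      using agree_mult[OF Sr aA aA hA hA _ hx, of x x'] that by (simp add: split)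
    then have "agr ({..<Suc r} \<union> ({..<i} - {r})) x x'"
      using rest by (simp add: agree_Un)
    then show ?thesis
      by (rule agree_mono) auto
  qed
  have h_agr: "agr {..<i} (h x) (h x')" if "i \<le> n" "x \<in> A" "x' \<in> A" "agr {..<i} x x'" for i x x'
    unfolding agree_def
  proof
    fix j assume j: "j \<in> {..<i}"
    then have "[\<kappa> j (h x) - \<kappa> j (h x') = c * (\<kappa> j x - \<kappa> j x')] (mod int (p j))"
      using that agree_mono[OF that(4), of "{..<j}"] by (intro hlin) auto
    also have "[c * (\<kappa> j x - \<kappa> j x') = c * 0] (mod int (p j))"
      using that j by (intro cong_mult cong_refl) (simp add: agree_def cong_diff_iff_cong_0)
    finally show "[\<kappa> j (h x) = \<kappa> j (h x')] (mod int (p j))"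
      by (simp add: cong_diff_iff_cong_0)
  qed
  have "loop_coordinates A circ e n p \<kappa>' (\<lambda>i. {j. j < i \<and> (i < Suc r \<longrightarrow> p j = p i)})"
  proof
    have ae: "a e = e"
      using split[OF unit_mem] right_unit[OF aA[OF unit_mem]] by (simp add: he)
    show "circ e x = x" "circ x e = x" if "x \<in> A" for x
      using that by (simp_all add: circ_def ae he left_unit right_unit mem hh split)
    show "x = y" if "x \<in> A" "y \<in> A" "agree p \<kappa>' {..<n} x y" for x y
      using old[OF le_refl that] separate that by blast
    fix i x x' y y'
    assume i: "i < n" and A: "x \<in> A" "x' \<in> A" "y \<in> A" "y' \<in> A"
      and x: "agree p \<kappa>' {j. j < i \<and> (i < Suc r \<longrightarrow> p j = p i)} x x'"
      and y: "agree p \<kappa>' {j. j < i \<and> (i < Suc r \<longrightarrow> p j = p i)} y y'"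
    consider "i < r" | "i = r" | "i > r"
      by linarith
    then show "[\<kappa>' i (circ x y) - \<kappa>' i (circ x' y') = (\<kappa>' i x - \<kappa>' i x') + (\<kappa>' i y - \<kappa>' i y')] (mod int (p i))"
    proof cases
      case 1
      then have "agr (dep i) x x'" "agr (dep i) y y'"
        using x y old_lt[of "dep i"] by (simp_all add: deps)
      then have "[\<kappa> i (m x y) - \<kappa> i (m x' y') = (\<kappa> i x - \<kappa> i x') + (\<kappa> i y - \<kappa> i y')] (mod int (p i))"
        using i A by (intro additive)
      moreover have "[\<kappa> i (circ x y) - \<kappa> i (circ x' y') = \<kappa> i (m x y) - \<kappa> i (m x' y')] (mod int (p i))"
        using circ_lt[OF A(1,3)] circ_lt[OF A(2,4)] 1 by (intro cong_diff) (auto simp: agree_def)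
      ultimately show ?thesis
        using 1 by (auto simp: \<kappa>'_def intro: cong_trans)
    next
      case 2
      have "{j. j < i \<and> (i < Suc r \<longrightarrow> p j = p i)} = I"
        using 2 by (auto simp: I_def)
      then have "agr I x x'" "agr I y y'"
        using x y old_lt[of I] by (simp_all add: I_def)
      moreover have "agr {..<r} (a z) (a z')" if "z \<in> A" "z' \<in> A" "agr I z z'" for z z'
        using agree_trans[OF agree_trans[OF aI[OF that(1)] that(3)] agree_sym[OF aI[OF that(2)]]]
          agree_trans[OF aJ[OF that(1)] agree_sym[OF aJ[OF that(2)]]]
        by (simp add: IJ agree_Un)
      ultimately have "agr (dep r) (a x) (a x')" "agr (dep r) (a y) (a y')"
        using A by (simp_all add: deps lessThan_def)
      then have "[\<kappa> r (m (a x) (a y)) - \<kappa> r (m (a x') (a y'))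
          = (\<kappa> r (a x) - \<kappa> r (a x')) + (\<kappa> r (a y) - \<kappa> r (a y'))] (mod int (p r))"
        using A r by (intro additive) (simp_all add: mem)
      moreover have "[\<kappa> r (a (circ x y)) - \<kappa> r (a (circ x' y'))
          = \<kappa> r (m (a x) (a y)) - \<kappa> r (m (a x') (a y'))] (mod int (p r))"
        using a_circ[OF A(1,3)] a_circ[OF A(2,4)] by (intro cong_diff) (auto simp: agree_def)
      ultimately show ?thesis
        using 2 by (auto simp: \<kappa>'_def intro: cong_trans)
    next
      case 3
      then have dep_i: "dep i = {..<i}" and "{j. j < i \<and> (i < Suc r \<longrightarrow> p j = p i)} = {..<i}"
        by (auto simp: deps)
      then have xx: "agr {..<i} x x'" and yy: "agr {..<i} y y'"
        using old[of i] x y A i by simp_all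
      have cl: "dep_closed {..<i}"
        using i by (intro dep_closed_lessThan) simp
      have hx: "agr {..<i} (h x) (h x')" and hy: "agr {..<i} (h y) (h y')"
        using h_agr i A xx yy by auto
      have ax: "agr {..<i} (a x) (a x')" and ay: "agr {..<i} (a y) (a y')"
        unfolding a_def using A xx yy hx hy by (auto intro!: agree_right_div cl simp: hA)
      have axy: "agr {..<i} (m (a x) (a y)) (m (a x') (a y'))"
        using A ax ay by (intro agree_mult cl) (simp_all add: mem)
      have hxy: "agr {..<i} (m (h x) (h y)) (m (h x') (h y'))"
        using A hx hy by (intro agree_mult cl) (simp_all add: mem)
      have add: "[\<kappa> i (m u v) - \<kappa> i (m u' v') = (\<kappa> i u - \<kappa> i u') + (\<kappa> i v - \<kappa> i v')] (mod int (p i))"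
        if "u \<in> A" "u' \<in> A" "v \<in> A" "v' \<in> A" "agr {..<i} u u'" "agr {..<i} v v'" for u u' v v'
        using that i by (intro additive) (simp_all add: dep_i)
      have cc: "[c * c = c] (mod int (p i))"
      proof (cases "p i = p r")
        case True
        then show ?thesis using cong_mult[OF c(1) cong_refl, of c] c(1) by (auto intro: cong_trans cong_sym)
      next
        case False
        then show ?thesis using cong_mult[OF c(2)[OF i] cong_refl, of c] by simp
      qed
      have "[\<kappa> i (circ x y) - \<kappa> i (circ x' y') = (\<kappa> i x - \<kappa> i x') + (\<kappa> i y - \<kappa> i y')] (mod int (p i))"
      proof (rule cong_recombine)
        show "[\<kappa> i x - \<kappa> i x' = (\<kappa> i (a x) - \<kappa> i (a x')) + (\<kappa> i (h x) - \<kappa> i (h x'))] (mod int (p i))"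
          using add[of "a x" "a x'" "h x" "h x'"] A ax hx by (simp add: mem split)
        show "[\<kappa> i y - \<kappa> i y' = (\<kappa> i (a y) - \<kappa> i (a y')) + (\<kappa> i (h y) - \<kappa> i (h y'))] (mod int (p i))"
          using add[of "a y" "a y'" "h y" "h y'"] A ay hy by (simp add: mem split)
        show "[\<kappa> i (h x) - \<kappa> i (h x') = c * (\<kappa> i x - \<kappa> i x')] (mod int (p i))"
          "[\<kappa> i (h y) - \<kappa> i (h y') = c * (\<kappa> i y - \<kappa> i y')] (mod int (p i))"
          using hlin i A xx yy by auto
        show "[\<kappa> i (m (a x) (a y)) - \<kappa> i (m (a x') (a y'))
            = (\<kappa> i (a x) - \<kappa> i (a x')) + (\<kappa> i (a y) - \<kappa> i (a y'))] (mod int (p i))"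
          using A ax ay by (intro add) (simp_all add: mem)
        show "[\<kappa> i (m (h x) (h y)) - \<kappa> i (m (h x') (h y'))
            = (\<kappa> i (h x) - \<kappa> i (h x')) + (\<kappa> i (h y) - \<kappa> i (h y'))] (mod int (p i))"
          using A hx hy by (intro add) (simp_all add: mem)
        show "[\<kappa> i (h (m (h x) (h y))) - \<kappa> i (h (m (h x') (h y')))
            = c * (\<kappa> i (m (h x) (h y)) - \<kappa> i (m (h x') (h y')))] (mod int (p i))"
          using A hxy i by (intro hlin) (simp_all add: mem)
        show "[\<kappa> i (circ x y) - \<kappa> i (circ x' y') = (\<kappa> i (m (a x) (a y)) - \<kappa> i (m (a x') (a y')))
            + (\<kappa> i (h (m (h x) (h y))) - \<kappa> i (h (m (h x') (h y'))))] (mod int (p i))"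
          unfolding circ_def using A axy h_agr[OF _ _ _ hxy] i by (intro add) (simp_all add: mem)
      qed (rule cc)
      then show ?thesis
        using 3 by (simp add: \<kappa>'_def)
    qed
  qed (auto simp: finite circA unit_mem prime)
  moreover have "pointwise_closed circ C" if C: "pointwise_closed m C" for C :: "('b \<Rightarrow> 'a) set"
  proof -
    have hC': "(\<lambda>x. h (f x)) \<in> C" if "f \<in> C" for f
      using hC[OF C that] .
    have mC: "(\<lambda>x. m (f x) (g x)) \<in> C" if "f \<in> C" "g \<in> C" for f g
      using C that by (simp add: pointwise_closed_def)
    have aC: "(\<lambda>x. a (f x)) \<in> C" if "f \<in> C" for f
      unfolding a_def right_div_def using pointwise_closed_right_power[OF C that hC'[OF that]] .
    show ?thesis
      unfolding pointwise_closed_def circ_def using mC hC' aC by simp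
  qed
  ultimately show thesis
    using that by blast
qed

end

lemma (in loop_coordinates) separate_primes:
  assumes deps: "\<And>i. dep i = {..<i}" and "r \<le> n"
  shows "\<exists>circ \<kappa>'. loop_coordinates A circ e n p \<kappa>' (\<lambda>i. {j. j < i \<and> (i < r \<longrightarrow> p j = p i)}) \<and>
    (\<forall>C :: ('b \<Rightarrow> 'a) set. pointwise_closed m C \<longrightarrow> pointwise_closed circ C)"
  using assms(2)
proof (induction r)
  case 0
  have "dep = (\<lambda>i. {j. j < i \<and> (i < 0 \<longrightarrow> p j = p i)})"
    using deps by (auto simp: fun_eq_iff)
  then have "loop_coordinates A m e n p \<kappa> (\<lambda>i. {j. j < i \<and> (i < 0 \<longrightarrow> p j = p i)})"
    using loop_coordinates_axioms by simp
  then show ?case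
    by blast
next
  case (Suc r)
  then obtain circ \<kappa>' where circ: "\<And>C :: ('b \<Rightarrow> 'a) set. pointwise_closed m C \<Longrightarrow> pointwise_closed circ C"
    and coords: "loop_coordinates A circ e n p \<kappa>' (\<lambda>i. {j. j < i \<and> (i < r \<longrightarrow> p j = p i)})"
    by auto
  interpret C: loop_coordinates A circ e n p \<kappa>' "\<lambda>i. {j. j < i \<and> (i < r \<longrightarrow> p j = p i)}"
    by (rule coords)
  have "r < n"
    using Suc.prems by simp
  then obtain circ' \<kappa>'' where
    "loop_coordinates A circ' e n p \<kappa>'' (\<lambda>i. {j. j < i \<and> (i < Suc r \<longrightarrow> p j = p i)})"
    "\<And>C :: ('b \<Rightarrow> 'a) set. pointwise_closed circ C \<Longrightarrow> pointwise_closed circ' C"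
    using C.separate_one_prime[where 'b = 'b] by blast
  then show ?case
    using circ by blast
qed

section \<open>Functions of low degree on the cube\<close>

text \<open>A point of the cube is given by the set of its coordinates equal to \<open>1\<close>. Modulo \<open>q\<close>, the functions
  of degree at most \<open>d\<close> in the \<open>0\<close>-\<open>1\<close> coordinates are the sums of functions that depend on at most
  \<open>d\<close> of them. In the latter form products are immediate, as no monomials have to be
  multiplied out.\<close>

inductive low_degree :: "int \<Rightarrow> nat \<Rightarrow> (nat set \<Rightarrow> int) \<Rightarrow> bool" for q d where
  junta: "finite T \<Longrightarrow> card T \<le> d \<Longrightarrow> (\<And>c. h (c \<inter> T) = h c) \<Longrightarrow> low_degree q d h"
| add: "low_degree q d g \<Longrightarrow> low_degree q d h \<Longrightarrow> low_degree q d (\<lambda>c. g c + h c)"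
| cong: "low_degree q d g \<Longrightarrow> (\<And>c. [h c = g c] (mod q)) \<Longrightarrow> low_degree q d h"

lemma low_degree_const: "low_degree q d (\<lambda>_. a)"
  by (rule low_degree.junta[of "{}"]) simp_all

lemma low_degree_mono: "low_degree q d h \<Longrightarrow> d \<le> d' \<Longrightarrow> low_degree q d' h"
proof (induction rule: low_degree.induct)
  case (junta T h)
  then show ?case by (intro low_degree.junta[of T]) auto
qed (blast intro: low_degree.intros)+

lemma low_degree_mult:
  assumes "low_degree q d g" "low_degree q d' h"
  shows "low_degree q (d + d') (\<lambda>c. g c * h c)"
  using assms(1)
proof (induction rule: low_degree.induct)
  case (junta T g)
  note g = junta
  show ?case
    using assms(2)
  proof (induction rule: low_degree.induct)
    case (junta S h)
    show ?case
    proof (rule low_degree.junta[of "T \<union> S"])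
      show "card (T \<union> S) \<le> d + d'"
        using g(2) junta(2) card_Un_le[of T S] by linarith
      fix c
      have "g (c \<inter> (T \<union> S)) = g c"
        using g(3)[of "c \<inter> (T \<union> S)"] g(3)[of c] by (simp add: Int_assoc Int_absorb1)
      moreover have "h (c \<inter> (T \<union> S)) = h c"
        using junta(3)[of "c \<inter> (T \<union> S)"] junta(3)[of c] by (simp add: Int_assoc Int_absorb1)
      ultimately show "g (c \<inter> (T \<union> S)) * h (c \<inter> (T \<union> S)) = g c * h c"
        by simp
    qed (use g junta in simp)
  next
    case (add h h')
    then show ?case
      using low_degree.add by (simp add: distrib_left)
  next
    case (cong h h')
    show ?case
      by (rule low_degree.cong[OF cong(3)]) (intro cong_mult cong_refl cong(2))
  qed
next
  case (add g g')
  then show ?case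
    using low_degree.add by (simp add: distrib_right)
next
  case (cong g g')
  show ?case
    by (rule low_degree.cong[OF cong(3)]) (intro cong_mult cong_refl cong(2))
qed

lemma low_degree_power: "low_degree q d h \<Longrightarrow> low_degree q (k * d) (\<lambda>c. h c ^ k)"
  by (induction k) (simp_all add: low_degree_const low_degree_mult)

lemma low_degree_sum:
  "(\<And>i. i \<in> I \<Longrightarrow> low_degree q d (h i)) \<Longrightarrow> low_degree q d (\<lambda>c. \<Sum>i\<in>I. h i c)"
  by (induction I rule: infinite_finite_induct) (simp_all add: low_degree_const low_degree.add)

lemma sum_Pow_insert:
  assumes "finite K" "j \<notin> K"
  shows "(\<Sum>c\<in>Pow (insert j K). f c) = (\<Sum>c\<in>Pow K. f c + f (insert j c) :: int)"
proof -
  have "inj_on (insert j) (Pow K)"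
    using assms(2) by (auto simp: inj_on_def)
  moreover have "Pow K \<inter> insert j ` Pow K = {}"
    using assms(2) by auto
  ultimately show ?thesis
    using assms(1) by (simp add: Pow_insert sum.union_disjoint sum.reindex sum.distrib)
qed

text \<open>A term of \<open>h\<close> that depends on the coordinates \<open>T\<close> contributes nothing to the edge differences in
  direction \<open>k\<close> unless \<open>k \<in> T\<close>. In that case \<open>T\<close> has at most \<open>d - 1\<close> further elements, so that it misses
  some \<open>j \<in> K\<close>, and the points with and without \<open>j\<close> cancel.\<close>

lemma low_degree_alternating_sum:
  assumes "low_degree q d h" and K: "finite K" "k \<notin> K" "d \<le> card K"
  shows "[(\<Sum>c\<in>Pow K. (-1) ^ card c * (h (insert k c) - h c)) = 0] (mod q)"
  using assms(1)
proof (induction rule: low_degree.induct)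
  case (junta T h)
  have eq: "h c = h c'" if "c \<inter> T = c' \<inter> T" for c c'
    using junta(3)[of c] junta(3)[of c'] that by simp
  show ?case
  proof (cases "k \<in> T")
    case False
    then have "h (insert k c) = h c" for c
      by (intro eq) auto
    then show ?thesis by simp
  next
    case True
    have "\<not> K \<subseteq> T - {k}"
    proof
      assume "K \<subseteq> T - {k}"
      then have "card K \<le> card (T - {k})"
        using junta(1) by (intro card_mono) auto
      also have "\<dots> < card T"
        using True junta(1) by (intro card_Diff1_less)
      finally show False
        using junta(2) K(3) by simp
    qed
    then obtain j where j: "j \<in> K" "j \<notin> T"
      using K(2) by blast
    define K' where "K' = K - {j}"
    have K': "K = insert j K'" "finite K'" "j \<notin> K'"
      using j K by (auto simp: K'_def)
    have "h (insert k (insert j c)) = h (insert k c)" "h (insert j c) = h c" for c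
      using j by (intro eq; auto)+
    moreover have "card (insert j c) = Suc (card c)" if "c \<in> Pow K'" for c
      using that K' finite_subset by (subst card_insert_disjoint) auto
    ultimately show ?thesis
      unfolding K'(1) by (simp add: sum_Pow_insert K')
  qed
next
  case (add g h)
  have "(\<Sum>c\<in>Pow K. (-1) ^ card c * ((g (insert k c) + h (insert k c)) - (g c + h c)))
      = (\<Sum>c\<in>Pow K. (-1) ^ card c * (g (insert k c) - g c))
      + (\<Sum>c\<in>Pow K. (-1) ^ card c * (h (insert k c) - h c))"
    by (simp add: sum.distrib[symmetric] algebra_simps)
  then show ?case
    using cong_add[OF add(3,4)] by simp
next
  case (cong g h)
  have "[(\<Sum>c\<in>Pow K. (-1) ^ card c * (h (insert k c) - h c))
      = (\<Sum>c\<in>Pow K. (-1) ^ card c * (g (insert k c) - g c))] (mod q)"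
    by (intro cong_sum cong_mult cong_refl cong_diff cong(2))
  then show ?case
    using cong(3) by (rule cong_trans)
qed

lemma fermat_int:
  fixes a :: int
  assumes "prime q" "\<not> int q dvd a"
  shows "[a ^ (q - 1) = 1] (mod int q)"
proof -
  define b where "b = nat (a mod int q)"
  have b: "int b = a mod int q"
    using assms(1) by (simp add: b_def prime_gt_0_nat)
  have "\<not> q dvd b"
    using assms(2) b by (metis dvd_mod_iff dvd_refl int_dvd_int_iff)
  then have "[b ^ (q - 1) = 1] (mod q)"
    using assms(1) fermat_theorem by blast
  then have "[int b ^ (q - 1) = 1] (mod int q)"
    by (metis cong_int_iff of_nat_1 of_nat_power)
  moreover have "[a ^ (q - 1) = int b ^ (q - 1)] (mod int q)"
    by (intro cong_pow) (simp add: b cong_def)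
  ultimately show ?thesis
    using cong_trans by blast
qed

text \<open>Interpolation over the field with \<open>q\<close> elements, one coordinate \<open>\<phi> j\<close> at a time: by Fermat,
  \<open>1 - (\<phi> j b - v)\<^sup>q\<^sup>-\<^sup>1\<close> is the indicator of \<open>\<phi> j b = v\<close>, and it has degree at most \<open>(q - 1) d\<close>.\<close>

lemma low_degree_compose:
  fixes \<phi> :: "'i \<Rightarrow> 'b \<Rightarrow> int" and u :: "nat set \<Rightarrow> 'b"
  assumes q: "prime q" and "finite J" and B: "\<And>c. u c \<in> B"
    and "\<And>j. j \<in> J \<Longrightarrow> low_degree (int q) d (\<lambda>c. \<phi> j (u c))"
    and "\<And>b b'. b \<in> B \<Longrightarrow> b' \<in> B \<Longrightarrow> (\<And>j. j \<in> J \<Longrightarrow> [\<phi> j b = \<phi> j b'] (mod int q)) \<Longrightarrow>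
          [G b = G b'] (mod int q)"
  shows "low_degree (int q) (card J * ((q - 1) * d)) (\<lambda>c. G (u c))"
  using assms(2,4,5)
proof (induction J arbitrary: G rule: finite_induct)
  case empty
  have "low_degree (int q) 0 (\<lambda>_. G (u {}))"
    by (rule low_degree_const)
  then show ?case
    using empty B by (auto intro: low_degree.cong)
next
  case (insert j J)
  \<comment> \<open>The function \<open>G' v\<close> is the restriction of \<open>G\<close> to the hyperplane with value \<open>v\<close> at \<open>j\<close>, read as a function of the
    coordinates in \<open>J\<close>; where \<open>S v b\<close> is empty, the value \<open>0\<close> is arbitrary.\<close>
  define S where "S v b = {b' \<in> B. [\<phi> j b' = int v] (mod int q) \<and> (\<forall>i\<in>J. [\<phi> i b' = \<phi> i b] (mod int q))}" for v b
  define G' where "G' v b = (if S v b = {} then 0 else G (SOME b'. b' \<in> S v b))" for v b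
  have "low_degree (int q) (card J * ((q - 1) * d)) (\<lambda>c. G' v (u c))" for v
  proof (rule insert.IH)
    show "low_degree (int q) d (\<lambda>c. \<phi> i (u c))" if "i \<in> J" for i
      using insert.prems(1) that by blast
    fix b b' assume "b \<in> B" "b' \<in> B" and bb: "\<And>i. i \<in> J \<Longrightarrow> [\<phi> i b = \<phi> i b'] (mod int q)"
    have "S v b = S v b'"
      unfolding S_def using bb by (meson cong_sym cong_trans)
    then show "[G' v b = G' v b'] (mod int q)"
      by (simp add: G'_def)
  qed
  moreover have "low_degree (int q) ((q - 1) * d) (\<lambda>c. 1 - (\<phi> j (u c) - int v) ^ (q - 1))" for v
  proof -
    have "low_degree (int q) d (\<lambda>c. \<phi> j (u c) + - int v)"
      using insert.prems(1) by (intro low_degree.add low_degree_const) auto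
    then have "low_degree (int q) ((q - 1) * d) (\<lambda>c. (\<phi> j (u c) + - int v) ^ (q - 1))"
      by (rule low_degree_power)
    then have "low_degree (int q) ((q - 1) * d) (\<lambda>c. -1 * (\<phi> j (u c) + - int v) ^ (q - 1))"
      using low_degree_mult[OF low_degree_const[of _ 0 "-1"]] by simp
    then have "low_degree (int q) ((q - 1) * d) (\<lambda>c. 1 + -1 * (\<phi> j (u c) + - int v) ^ (q - 1))"
      by (intro low_degree.add low_degree_const)
    then show ?thesis by simp
  qed
  ultimately have "low_degree (int q) ((q - 1) * d + card J * ((q - 1) * d))
      (\<lambda>c. (1 - (\<phi> j (u c) - int v) ^ (q - 1)) * G' v (u c))" for v
    by (intro low_degree_mult)
  then have "low_degree (int q) ((q - 1) * d + card J * ((q - 1) * d))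
      (\<lambda>c. \<Sum>v<q. (1 - (\<phi> j (u c) - int v) ^ (q - 1)) * G' v (u c))"
    by (intro low_degree_sum)
  moreover have "[G b = (\<Sum>v<q. (1 - (\<phi> j b - int v) ^ (q - 1)) * G' v b)] (mod int q)" if b: "b \<in> B" for b
  proof -
    define w where "w = nat (\<phi> j b mod int q)"
    have q0: "q > 1"
      using q prime_gt_1_nat by blast
    then have w: "w < q" "[\<phi> j b = int w] (mod int q)"
      by (auto simp: w_def nat_less_iff cong_def)
    have zero: "[(1 - (\<phi> j b - int v) ^ (q - 1)) * G' v b = 0] (mod int q)" if v: "v \<in> {..<q} - {w}" for v
    proof -
      have "\<not> [int w = int v] (mod int q)"
        using v w(1) by (auto simp: cong_int_iff cong_def)
      then have "\<not> int q dvd \<phi> j b - int v"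
        using w(2) by (metis cong_iff_dvd_diff cong_sym cong_trans)
      then have "[1 - (\<phi> j b - int v) ^ (q - 1) = 1 - 1] (mod int q)"
        using q by (intro cong_diff cong_refl fermat_int)
      then show ?thesis
        using cong_mult[OF _ cong_refl] by fastforce
    qed
    have "b \<in> S w b"
      using b w by (simp add: S_def)
    then have "(SOME b'. b' \<in> S w b) \<in> S w b"
      by (metis someI)
    then have "[G b = G (SOME b'. b' \<in> S w b)] (mod int q)"
      using b w(2) by (intro insert.prems(2)) (auto simp: S_def intro: cong_sym cong_trans)
    then have "[G b = G' w b] (mod int q)"
      using \<open>b \<in> S w b\<close> by (auto simp: G'_def)
    moreover have "[(1 - (\<phi> j b - int w) ^ (q - 1)) * G' w b = (1 - 0 ^ (q - 1)) * G' w b] (mod int q)"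
      using w(2) by (intro cong_mult cong_diff cong_refl cong_pow) (simp add: cong_diff_iff_cong_0)
    ultimately have "[G b = (1 - (\<phi> j b - int w) ^ (q - 1)) * G' w b] (mod int q)"
      using q0 cong_trans[OF _ cong_sym] by (simp add: zero_power)
    moreover have "[(\<Sum>v\<in>{..<q} - {w}. (1 - (\<phi> j b - int v) ^ (q - 1)) * G' v b) = (\<Sum>v\<in>{..<q} - {w}. 0)] (mod int q)"
      by (intro cong_sum zero)
    ultimately have "[G b + 0 = (1 - (\<phi> j b - int w) ^ (q - 1)) * G' w b
        + (\<Sum>v\<in>{..<q} - {w}. (1 - (\<phi> j b - int v) ^ (q - 1)) * G' v b)] (mod int q)"
      by (intro cong_add) (simp_all add: cong_sym)
    then show ?thesis
      using w(1) by (simp add: sum.remove[of "{..<q}" w])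
  qed
  ultimately have "low_degree (int q) ((q - 1) * d + card J * ((q - 1) * d)) (\<lambda>c. G (u c))"
    using B by (auto intro: low_degree.cong)
  then show ?case
    using insert.hyps by simp
qed

section \<open>Coordinates in which the primes do not interact give supernilpotence\<close>

text \<open>The concatenated argument lists of the term condition, with the last block treated like the others:
  \<open>c\<close> is the set of blocks in which the second tuple is chosen.\<close>

definition cube_point :: "'a list list \<Rightarrow> 'a list list \<Rightarrow> nat \<Rightarrow> nat set \<Rightarrow> 'a list" where
  "cube_point as bs k c = concat (map (\<lambda>i. if i \<in> c then bs ! i else as ! i) [0..<k])"

lemma cube_point_Suc:
  "cube_point as bs (Suc k) c = cube_point as bs k c @ (if k \<in> c then bs ! k else as ! k)"
  by (simp add: cube_point_def)

lemma length_cube_point: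
  assumes "\<And>i. i < k \<Longrightarrow> length (as ! i) = length (bs ! i)"
  shows "length (cube_point as bs k c) = (\<Sum>i<k. length (as ! i))"
  using assms by (induction k) (auto simp: cube_point_Suc cube_point_def[of _ _ 0])

lemma cube_point_entry:
  assumes "\<And>i. i < k \<Longrightarrow> length (as ! i) = length (bs ! i)" "l < (\<Sum>i<k. length (as ! i))"
  obtains j where "\<And>c. cube_point as bs k (c \<inter> {j}) ! l = cube_point as bs k c ! l"
  using assms
proof (induction k arbitrary: thesis)
  case (Suc k)
  have len: "length (cube_point as bs k c) = (\<Sum>i<k. length (as ! i))" for c
    using Suc.prems(2) by (intro length_cube_point) simp
  show ?case
  proof (cases "l < (\<Sum>i<k. length (as ! i))")
    case True
    then obtain j where "\<And>c. cube_point as bs k (c \<inter> {j}) ! l = cube_point as bs k c ! l"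
      using Suc by (metis less_Suc_eq)
    then have "cube_point as bs (Suc k) (c \<inter> {j}) ! l = cube_point as bs (Suc k) c ! l" for c
      using True by (simp add: cube_point_Suc nth_append len)
    then show ?thesis
      by (rule Suc.prems(1))
  next
    case False
    then have "cube_point as bs (Suc k) (c \<inter> {k}) ! l = cube_point as bs (Suc k) c ! l" for c
      by (simp add: cube_point_Suc nth_append len)
    then show ?thesis
      by (rule Suc.prems(1))
  qed
qed simp

lemma set_cube_point:
  assumes "\<And>i. i < k \<Longrightarrow> set (as ! i) \<subseteq> A \<and> set (bs ! i) \<subseteq> A"
  shows "set (cube_point as bs k c) \<subseteq> A"
  using assms by (induction k) (auto simp: cube_point_Suc cube_point_def[of _ _ 0])

text \<open>A polynomial operation evaluated at the points of such a cube is composed from its arguments, each of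
  which varies with a single coordinate of the cube, and from constants. The rule \<open>edge\<close> covers both.\<close>

inductive_set cube_maps :: "'a set \<Rightarrow> ('a \<Rightarrow> 'a \<Rightarrow> 'a) \<Rightarrow> (nat set \<Rightarrow> 'a) set" for A m where
  edge: "(\<And>c. u c \<in> A) \<Longrightarrow> (\<And>c. u (c \<inter> {j}) = u c) \<Longrightarrow> u \<in> cube_maps A m"
| mult: "u \<in> cube_maps A m \<Longrightarrow> v \<in> cube_maps A m \<Longrightarrow> (\<lambda>c. m (u c) (v c)) \<in> cube_maps A m"

lemma polynomial_operation_cube_maps:
  assumes "polynomial_operation A (groupoid_operations m) N f"
    and A: "\<And>u c. u \<in> cube_maps A m \<Longrightarrow> u c \<in> A"
    and len: "\<And>c. length (v c) = N" and v: "\<And>l. l < N \<Longrightarrow> (\<lambda>c. v c ! l) \<in> cube_maps A m"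
  shows "(\<lambda>c. f (v c)) \<in> cube_maps A m"
  using assms(1) unfolding polynomial_operation_def
proof (induction rule: term_operation.induct)
  case (proj i)
  then show ?case by (rule v)
next
  case (comp k f gs)
  show ?case
  proof (cases "(k, f) \<in> groupoid_operations m")
    case True
    then have f: "k = 2" "f = binary m"
      by (simp_all add: groupoid_operations_def)
    then obtain g g' where "gs = [g, g']"
      using comp(2) by (auto simp: numeral_2_eq_2 length_Suc_conv)
    then show ?thesis
      using comp(3) f by (auto simp: binary_def intro: cube_maps.mult)
  next
    case False
    then obtain a where "a \<in> A" "f = (\<lambda>_. a)"
      using comp(1) by auto
    then show ?thesis
      by (auto intro: cube_maps.edge)
  qed
next
  case (ext g f)
  have "set (v c) \<subseteq> A" for c
    using A[OF v] len by (metis in_set_conv_nth subsetI)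
  then have "(\<lambda>c. f (v c)) = (\<lambda>c. g (v c))"
    using ext(2) len by simp
  then show ?case
    using ext(3) by simp
qed

context loop_coordinates
begin

lemma cube_maps_closed: "u \<in> cube_maps A m \<Longrightarrow> u c \<in> A"
  by (induction rule: cube_maps.induct) (auto intro: closed)

text \<open>The bound depends only on the coordinates of the loop, not on the dimension of the cube. It is
  preserved by multiplication because \<open>\<kappa> i (m x y)\<close> is the sum of \<open>\<kappa> i x\<close>, \<open>\<kappa> i y\<close> and a fixed function \<open>G\<close>
  of lower coordinates modulo the same prime, whose degrees are already bounded.\<close>

lemma bounded_degree:
  assumes prime_dep: "\<And>i j. i < n \<Longrightarrow> j \<in> dep i \<Longrightarrow> p j = p i"
  shows "i < n \<Longrightarrow> \<exists>d. \<forall>u\<in>cube_maps A m. low_degree (int (p i)) d (\<lambda>c. \<kappa> i (u c))"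
proof (induction i rule: less_induct)
  case (less i)
  have dep_i: "dep i \<subseteq> {..<i}"
    using dep less.prems .
  then have "\<forall>j\<in>dep i. \<exists>d. \<forall>u\<in>cube_maps A m. low_degree (int (p j)) d (\<lambda>c. \<kappa> j (u c))"
    using less.IH less.prems by (meson lessThan_iff less_trans subsetD)
  then obtain b where b: "\<And>j u. j \<in> dep i \<Longrightarrow> u \<in> cube_maps A m \<Longrightarrow>
      low_degree (int (p j)) (b j) (\<lambda>c. \<kappa> j (u c))"
    by metis
  have fin: "finite (dep i)"
    using dep_i finite_subset by blast
  define B where "B = sum b (dep i)"
  have B: "low_degree (int (p i)) B (\<lambda>c. \<kappa> j (u c))" if "j \<in> dep i" "u \<in> cube_maps A m" for j u
    using low_degree_mono[OF b[OF that]] member_le_sum[of j "dep i" b] that fin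
      prime_dep[OF less.prems that(1)] by (simp add: B_def)
  define G where "G z = \<kappa> i (m (fst z) (snd z)) - \<kappa> i (fst z) - \<kappa> i (snd z)" for z
  \<comment> \<open>The arguments of \<open>G\<close>: the coordinates in \<open>dep i\<close> of both factors.\<close>
  define J where "J = (UNIV :: bool set) \<times> dep i"
  define \<phi> where "\<phi> s z = \<kappa> (snd s) (if fst s then fst z else snd z)" for s :: "bool \<times> nat" and z
  define D where "D = Suc (card J * ((p i - 1) * B))"
  have G: "low_degree (int (p i)) D (\<lambda>c. G (u c, v c))" if uv: "u \<in> cube_maps A m" "v \<in> cube_maps A m" for u v
  proof -
    have "low_degree (int (p i)) (card J * ((p i - 1) * B)) (\<lambda>c. G (u c, v c))"
    proof (rule low_degree_compose[where B = "A \<times> A" and \<phi> = \<phi>])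
      show "prime (p i)"
        using prime less.prems .
      show "finite J"
        using fin by (simp add: J_def)
      show "(u c, v c) \<in> A \<times> A" for c
        using uv cube_maps_closed by blast
      show "low_degree (int (p i)) B (\<lambda>c. \<phi> s (u c, v c))" if "s \<in> J" for s
        using that B uv by (cases "fst s") (auto simp: J_def \<phi>_def)
      fix z z' assume z: "z \<in> A \<times> A" "z' \<in> A \<times> A" and eq: "\<And>s. s \<in> J \<Longrightarrow> [\<phi> s z = \<phi> s z'] (mod int (p i))"
      have "agr (dep i) (fst z) (fst z')" "agr (dep i) (snd z) (snd z')"
        using eq[of "(True, _)"] eq[of "(False, _)"] prime_dep[OF less.prems]
        by (auto simp: agree_def J_def \<phi>_def)
      then have "[\<kappa> i (m (fst z) (snd z)) - \<kappa> i (m (fst z') (snd z'))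
          = (\<kappa> i (fst z) - \<kappa> i (fst z')) + (\<kappa> i (snd z) - \<kappa> i (snd z'))] (mod int (p i))"
        using z less.prems by (intro additive) auto
      then show "[G z = G z'] (mod int (p i))"
        by (simp add: G_def cong_iff_dvd_diff algebra_simps)
    qed
    then show ?thesis
      by (rule low_degree_mono) (simp add: D_def)
  qed
  have "low_degree (int (p i)) D (\<lambda>c. \<kappa> i (u c))" if "u \<in> cube_maps A m" for u
    using that
  proof (induction rule: cube_maps.induct)
    case (edge u j)
    then show ?case
      by (intro low_degree.junta[of "{j}"]) (simp_all add: D_def)
  next
    case (mult u v)
    have "low_degree (int (p i)) D (\<lambda>c. (\<kappa> i (u c) + \<kappa> i (v c)) + G (u c, v c))"
      using mult by (intro low_degree.add G)
    then show ?case
      by (simp add: G_def)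
  qed
  then show ?case
    by blast
qed

text \<open>In the alternating sum of the edge differences in direction \<open>k\<close>, all terms but one vanish by
  assumption, hence so does the last one.\<close>

lemma top_edge_constant:
  assumes u: "u \<in> cube_maps A m"
    and deg: "\<And>i. i < n \<Longrightarrow> low_degree (int (p i)) k (\<lambda>c. \<kappa> i (u c))"
    and eq: "\<And>c. c \<subset> {..<k} \<Longrightarrow> u (insert k c) = u c"
  shows "u {..<Suc k} = u {..<k}"
proof (rule separate)
  show "agr {..<n} (u {..<Suc k}) (u {..<k})"
    unfolding agree_def
  proof
    fix i assume "i \<in> {..<n}"
    then have "[(\<Sum>c\<in>Pow {..<k}. (-1) ^ card c * (\<kappa> i (u (insert k c)) - \<kappa> i (u c))) = 0] (mod int (p i))"
      using deg by (intro low_degree_alternating_sum[where d = k]) auto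
    moreover have "(\<Sum>c\<in>Pow {..<k} - {{..<k}}. (-1) ^ card c * (\<kappa> i (u (insert k c)) - \<kappa> i (u c))) = 0"
      by (intro sum.neutral ballI) (simp add: eq psubset_eq)
    then have "(\<Sum>c\<in>Pow {..<k}. (-1) ^ card c * (\<kappa> i (u (insert k c)) - \<kappa> i (u c)))
        = (-1) ^ k * (\<kappa> i (u {..<Suc k}) - \<kappa> i (u {..<k}))"
      by (subst sum.remove[of _ "{..<k}"]) (simp_all add: lessThan_Suc)
    ultimately have "int (p i) dvd (-1) ^ k * (\<kappa> i (u {..<Suc k}) - \<kappa> i (u {..<k}))"
      by (simp add: cong_0_iff)
    then have "int (p i) dvd \<kappa> i (u {..<Suc k}) - \<kappa> i (u {..<k})"
      by (cases "even k") (simp_all add: dvd_diff_commute)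
    then show "[\<kappa> i (u {..<Suc k}) = \<kappa> i (u {..<k})] (mod int (p i))"
      by (simp add: cong_iff_dvd_diff)
  qed
qed (use u cube_maps_closed in auto)

lemma is_supernilpotent:
  assumes "\<And>i j. i < n \<Longrightarrow> j \<in> dep i \<Longrightarrow> p j = p i"
  shows "is_supernilpotent A (groupoid_operations m)"
proof -
  let ?F = "groupoid_operations m"
  have "\<forall>i\<in>{..<n}. \<exists>d. \<forall>u\<in>cube_maps A m. low_degree (int (p i)) d (\<lambda>c. \<kappa> i (u c))"
    using bounded_degree assms by simp
  then obtain d where d: "\<And>i u. i < n \<Longrightarrow> u \<in> cube_maps A m \<Longrightarrow> low_degree (int (p i)) (d i) (\<lambda>c. \<kappa> i (u c))"
    by (metis lessThan_iff)
  \<comment> \<open>Large enough for all coordinates at once; \<open>Suc\<close> gives \<open>k \<ge> 1\<close>.\<close>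
  define k where "k = Suc (\<Sum>i<n. d i)"
  have deg: "low_degree (int (p i)) k (\<lambda>c. \<kappa> i (u c))" if "i < n" "u \<in> cube_maps A m" for i u
    using low_degree_mono[OF d[OF that]] member_le_sum[of i "{..<n}" d] that by (simp add: k_def)
  have alg: "is_algebra A ?F"
    using closed by (auto simp: is_algebra_def groupoid_operations_def binary_def subset_iff)
  have cong: "is_congruence A ?F (Id_on A)"
    unfolding is_congruence_def
  proof (intro conjI ballI)
    show "equiv A (Id_on A)"
      by (auto simp: equiv_def refl_on_def sym_def trans_def)
    have "xs = ys \<and> set xs \<subseteq> A" if "list_all2 (\<lambda>x y. (x, y) \<in> Id_on A) xs ys" for xs ys
      using that by (induction rule: list_all2_induct) auto
    then show "case x of (N, f) \<Rightarrow> \<forall>xs ys. length xs = N \<and> list_all2 (\<lambda>x y. (x, y) \<in> Id_on A) xs ys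
        \<longrightarrow> (f xs, f ys) \<in> Id_on A" if "x \<in> ?F" for x
      using alg that by (fastforce simp: is_algebra_def)
  qed
  have tc: "term_condition A ?F (replicate (k + 1) (A \<times> A)) (Id_on A)"
    unfolding term_condition_def
  proof (intro allI impI, elim conjE, goal_cases)
    case (1 f as bs)
    have len: "length as = Suc k" "length bs = Suc k"
      using 1 by simp_all
    have blocks: "list_all2 (\<lambda>x y. (x, y) \<in> A \<times> A) (as ! i) (bs ! i)" if "i < Suc k" for i
      using 1(3) that by (auto simp del: replicate_Suc)
    have el: "length (as ! i) = length (bs ! i)" "set (as ! i) \<subseteq> A \<and> set (bs ! i) \<subseteq> A" if "i < Suc k" for i
      using blocks[OF that] by (auto simp: list_all2_conv_all_nth in_set_conv_nth)
    let ?v = "cube_point as bs (Suc k)"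
    let ?u = "\<lambda>c. f (?v c)"
    have lenv: "length (?v c) = (\<Sum>i<Suc k. length (as ! i))" for c
      using el by (intro length_cube_point) simp
    have "?v {} = concat (map ((!) as) [0..<length as])"
      unfolding cube_point_def len(1) by simp
    then have "?v {} = concat as"
      unfolding map_nth .
    then have N: "length (concat as) = (\<Sum>i<Suc k. length (as ! i))"
      using lenv[of "{}"] by simp
    have entries: "(\<lambda>c. ?v c ! l) \<in> cube_maps A m" if l: "l < length (concat as)" for l
    proof -
      obtain j where "\<And>c. ?v (c \<inter> {j}) ! l = ?v c ! l"
        using cube_point_entry[of "Suc k" as bs l] el(1) l N by auto
      moreover have "?v c ! l \<in> A" for c
        using set_cube_point[of "Suc k" as A bs c] el(2) l lenv N by (metis nth_mem subsetD)
      ultimately show ?thesis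
        by (intro cube_maps.edge)
    qed
    have u: "?u \<in> cube_maps A m"
    proof (rule polynomial_operation_cube_maps[OF 1(4)])
      show "w c \<in> A" if "w \<in> cube_maps A m" for w c
        using that by (rule cube_maps_closed)
    qed (use lenv N entries in auto)
    have last: "last as = as ! k" "last bs = bs ! k"
      using len by (simp_all add: last_conv_nth flip: length_greater_0_conv)
    have choice: "?v c = concat (choose_blocks (\<lambda>i. i \<in> c) as bs) @ (if k \<in> c then last bs else last as)" for c
      by (simp add: cube_point_def choose_blocks_def len last)
    have butlast: "choose_blocks (\<lambda>i. i \<in> {..<k}) as bs = butlast bs"
      "choose_blocks (\<lambda>i. i \<in> {..<Suc k}) as bs = butlast bs"
      using len by (auto simp: choose_blocks_def list_eq_iff_nth_eq nth_butlast)
    have "?u {..<Suc k} = ?u {..<k}"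
    proof (rule top_edge_constant[OF u])
      fix c assume c: "c \<subset> {..<k}"
      then have "\<exists>i<length (replicate (k + 1) (A \<times> A)) - 1. \<not> (i \<in> c)"
        by auto
      then have "(f (concat (choose_blocks (\<lambda>i. i \<in> c) as bs) @ last as),
                  f (concat (choose_blocks (\<lambda>i. i \<in> c) as bs) @ last bs)) \<in> Id_on A"
        using 1(5)[rule_format, of "\<lambda>i. i \<in> c"] by blast
      moreover have "choose_blocks (\<lambda>i. i \<in> insert k c) as bs = choose_blocks (\<lambda>i. i \<in> c) as bs"
        by (auto simp: choose_blocks_def len)
      moreover have "k \<notin> c"
        using c by auto
      ultimately show "?u (insert k c) = ?u c"
        by (auto simp: choice)
    qed (use deg u in simp)
    then have "f (concat (butlast bs) @ last bs) = f (concat (butlast bs) @ last as)"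
      unfolding choice butlast by simp
    moreover have "?u {..<Suc k} \<in> A"
      using cube_maps_closed[OF u] by simp
    then have "f (concat (butlast bs) @ last bs) \<in> A"
      unfolding choice butlast by simp
    ultimately show ?case
      by auto
  qed
  have "commutator A ?F (replicate (k + 1) (A \<times> A)) = Id_on A"
  proof (rule equalityI)
    show "commutator A ?F (replicate (k + 1) (A \<times> A)) \<subseteq> Id_on A"
      by (rule commutator_least(3)[OF alg _ _ cong tc]) (simp_all del: replicate_Suc)
    have "is_congruence A ?F (commutator A ?F (replicate (k + 1) (A \<times> A)))"
      by (rule commutator_least(1)[OF alg]) (simp_all del: replicate_Suc)
    then show "Id_on A \<subseteq> commutator A ?F (replicate (k + 1) (A \<times> A))"
      by (auto simp: is_congruence_def equiv_def refl_on_def)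
  qed
  then show ?thesis
    unfolding is_supernilpotent_def by (intro exI[of _ k]) (simp add: k_def)
qed

end

section \<open>Coordinates of a nilpotent loop\<close>

locale finite_loop =
  fixes A :: "'a set" and m :: "'a \<Rightarrow> 'a \<Rightarrow> 'a" and e :: 'a
  assumes finite: "finite A"
    and closed: "\<And>x y. x \<in> A \<Longrightarrow> y \<in> A \<Longrightarrow> m x y \<in> A"
    and unit_mem: "e \<in> A"
    and left_unit: "\<And>x. x \<in> A \<Longrightarrow> m e x = x"
    and right_unit: "\<And>x. x \<in> A \<Longrightarrow> m x e = x"
    and left_cancel: "\<And>a x y. a \<in> A \<Longrightarrow> x \<in> A \<Longrightarrow> y \<in> A \<Longrightarrow> m a x = m a y \<Longrightarrow> x = y"
    and right_cancel: "\<And>a x y. a \<in> A \<Longrightarrow> x \<in> A \<Longrightarrow> y \<in> A \<Longrightarrow> m x a = m y a \<Longrightarrow> x = y"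

lemma finite_loop_if_is_loop:
  assumes "finite A" "is_loop A m"
  obtains e where "finite_loop A m e"
proof -
  obtain e where e: "e \<in> A" "\<forall>x\<in>A. m e x = x \<and> m x e = x"
    and closed: "\<forall>x\<in>A. \<forall>y\<in>A. m x y \<in> A"
    and solve: "\<forall>a\<in>A. \<forall>b\<in>A. (\<exists>!x. x \<in> A \<and> m a x = b) \<and> (\<exists>!y. y \<in> A \<and> m y a = b)"
    using assms(2) unfolding is_loop_def by (elim conjE bexE) (rule that)
  have "finite_loop A m e"
  proof
    fix a x y assume A: "a \<in> A" "x \<in> A" "y \<in> A"
    then have "\<exists>!z. z \<in> A \<and> m a z = m a x" "\<exists>!z. z \<in> A \<and> m z a = m x a"
      using solve closed by simp_all
    then show "m a x = m a y \<Longrightarrow> x = y" "m x a = m y a \<Longrightarrow> x = y"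
      using A by auto
  qed (use assms(1) e closed in auto)
  then show thesis
    by (rule that)
qed

text \<open>Modulo the next term of the series, left multiplication by \<open>a\<close> commutes with all translations; for
  \<open>y = e\<close> the second identity says that \<open>a\<close> commutes with \<open>x\<close>. Formulated by products with some \<open>z\<close>
  rather than by congruences, this passes to homomorphic images at once.\<close>

definition central_series :: "'a set \<Rightarrow> ('a \<Rightarrow> 'a \<Rightarrow> 'a) \<Rightarrow> 'a \<Rightarrow> (nat \<Rightarrow> 'a set) \<Rightarrow> nat \<Rightarrow> bool" where
  "central_series A m e N k \<longleftrightarrow> N 0 = A \<and> N k \<subseteq> {e} \<and> (\<forall>i. N i \<subseteq> A) \<and>
     (\<forall>i<k. \<forall>a\<in>N i. \<forall>x\<in>A. \<forall>y\<in>A.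
        (\<exists>z\<in>N (Suc i). m (m a x) y = m (m a (m x y)) z) \<and>
        (\<exists>z\<in>N (Suc i). m x (m a y) = m (m a (m x y)) z))"

lemma central_seriesD:
  assumes "central_series A m e N k" "i < k" "a \<in> N i" "x \<in> A" "y \<in> A"
  shows "\<exists>z\<in>N (Suc i). m (m a x) y = m (m a (m x y)) z"
    and "\<exists>z\<in>N (Suc i). m x (m a y) = m (m a (m x y)) z"
  using assms(1)[unfolded central_series_def, THEN conjunct2, THEN conjunct2, THEN conjunct2,
      rule_format, OF assms(2-5)] by simp_all

lemma term_operation_binary:
  assumes "(2, binary m) \<in> F" "term_operation A F n f" "term_operation A F n g"
  shows "term_operation A F n (\<lambda>xs. m (f xs) (g xs))"
  using term_operation.comp[of 2 "binary m" F "[f, g]" A n] assms by (simp add: binary_def)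

lemma term_condition_binary:
  assumes tc: "term_condition A F [\<alpha>, \<beta>] \<delta>"
    and f: "polynomial_operation A F (Suc (length xs)) f"
    and uv: "(u, v) \<in> \<alpha>" and xs: "list_all2 (\<lambda>x y. (x, y) \<in> \<beta>) xs ys"
    and eq: "(f (u # xs), f (u # ys)) \<in> \<delta>"
  shows "(f (v # xs), f (v # ys)) \<in> \<delta>"
proof -
  have "(f (concat (butlast [[v], ys]) @ last [[u], xs]), f (concat (butlast [[v], ys]) @ last [[v], ys])) \<in> \<delta>"
  proof (rule tc[unfolded term_condition_def, rule_format], intro conjI allI impI)
    show "list_all2 (\<lambda>x y. (x, y) \<in> [\<alpha>, \<beta>] ! i) ([[u], xs] ! i) ([[v], ys] ! i)"
      if "i < length [\<alpha>, \<beta>]" for i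
      using that uv xs by (auto simp: less_Suc_eq)
    show "polynomial_operation A F (length (concat [[u], xs])) f"
      using f by simp
    show "(f (concat (choose_blocks c [[u], xs] [[v], ys]) @ last [[u], xs]),
           f (concat (choose_blocks c [[u], xs] [[v], ys]) @ last [[v], ys])) \<in> \<delta>"
      if "\<exists>i<length [\<alpha>, \<beta>] - 1. \<not> c i" for c
      using that eq by (simp add: choose_blocks_def)
  qed simp_all
  then show ?thesis
    by simp
qed

context finite_loop
begin

lemma left_solve:
  assumes "a \<in> A" "b \<in> A"
  shows "\<exists>z\<in>A. m a z = b"
proof -
  have "inj_on (m a) A"
    by (rule inj_onI) (rule left_cancel[OF assms(1)])
  moreover have "m a ` A \<subseteq> A"
    using assms(1) closed by auto
  ultimately have "m a ` A = A"
    by (intro endo_inj_surj finite)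
  then show ?thesis
    using assms(2) by (metis imageE)
qed

text \<open>Left multiplication by \<open>b\<close> acts injectively on the pairs in \<open>\<delta>\<close>, of which there are finitely many, and so
  surjectively.\<close>

lemma congruence_left_cancel:
  assumes \<delta>: "is_congruence A (groupoid_operations m) \<delta>"
    and A: "b \<in> A" "x \<in> A" "y \<in> A" and eq: "(m b x, m b y) \<in> \<delta>"
  shows "(x, y) \<in> \<delta>"
proof -
  have eqv: "equiv A \<delta>" and sub: "\<delta> \<subseteq> A \<times> A"
    using \<delta> by (auto simp: is_congruence_def equiv_def refl_on_def)
  let ?h = "\<lambda>(x, y). (m b x, m b y)"
  have "(m b u, m b v) \<in> \<delta>" if "(u, v) \<in> \<delta>" for u v
  proof -
    have "list_all2 (\<lambda>x y. (x, y) \<in> \<delta>) [b, u] [b, v]"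
      using that A(1) eqv by (auto simp: equiv_def refl_on_def)
    moreover have "(2, binary m) \<in> groupoid_operations m"
      by (simp add: groupoid_operations_def)
    ultimately have "(binary m [b, u], binary m [b, v]) \<in> \<delta>"
      using \<delta> unfolding is_congruence_def by fastforce
    then show ?thesis
      by (simp add: binary_def)
  qed
  moreover have "inj_on ?h (A \<times> A)"
    by (auto simp: inj_on_def intro: left_cancel[OF A(1)])
  then have "inj_on ?h \<delta>"
    using sub by (rule inj_on_subset)
  moreover have "finite \<delta>"
    using sub by (rule finite_subset) (simp add: finite)
  ultimately have "?h ` \<delta> = \<delta>"
    by (intro endo_inj_surj) auto
  then have "(m b x, m b y) \<in> ?h ` \<delta>"
    using eq by simp
  then obtain u v where uv: "(u, v) \<in> \<delta>" "m b x = m b u" "m b y = m b v"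
    by auto
  then have "u \<in> A" "v \<in> A"
    using sub by auto
  then have "x = u" "y = v"
    using left_cancel[OF A(1,2)] left_cancel[OF A(1,3)] uv by simp_all
  then show ?thesis
    using uv by simp
qed

text \<open>The classes of \<open>e\<close> form the series. Applying the term condition to \<open>(u v) w\<close>, at the tuples
  \<open>(x, y)\<close> and \<open>(xy, e)\<close> with the same value for \<open>u = e\<close>, relates \<open>(a x) y\<close> to \<open>a (x y)\<close>; applying it to
  \<open>v (u w)\<close> at \<open>(x, y)\<close> and \<open>(e, xy)\<close> relates \<open>x (a y)\<close> to \<open>a (x y)\<close>.\<close>

lemma nilpotent_central_series:
  assumes "is_nilpotent A (groupoid_operations m)"
  obtains N k where "central_series A m e N k"
proof -
  let ?F = "groupoid_operations m"
  let ?G = "?F \<union> {(0, \<lambda>_. a) | a. a \<in> A}"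
  obtain k and \<alpha> :: "nat \<Rightarrow> 'a rel" where cong: "\<forall>i\<le>k. is_congruence A ?F (\<alpha> i)"
    and ends: "\<alpha> 0 = A \<times> A" "\<alpha> k = Id_on A"
    and com: "\<forall>i<k. \<alpha> (Suc i) \<subseteq> \<alpha> i \<and> commutator A ?F [\<alpha> i, A \<times> A] \<subseteq> \<alpha> (Suc i)"
    using assms unfolding is_nilpotent_def by (elim exE conjE) (rule that)
  define N where "N i = {a \<in> A. (e, a) \<in> \<alpha> i}" for i
  have alg: "is_algebra A ?F"
    using closed by (auto simp: is_algebra_def groupoid_operations_def binary_def subset_iff)
  have "central_series A m e N k"
    unfolding central_series_def
  proof (intro conjI allI impI ballI)
    show "N 0 = A" "N k \<subseteq> {e}" "N i \<subseteq> A" for i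
      using unit_mem by (auto simp: N_def ends)
    fix i a x y assume i: "i < k" and a: "a \<in> N i" and xy: "x \<in> A" "y \<in> A"
    have sub: "\<beta> \<subseteq> A \<times> A" if "\<beta> \<in> set [\<alpha> i, A \<times> A]" for \<beta>
      using that cong[rule_format, of i] i by (auto simp: is_congruence_def equiv_def refl_on_def)
    let ?C = "commutator A ?F [\<alpha> i, A \<times> A]"
    have tc: "term_condition A ?F [\<alpha> i, A \<times> A] ?C"
      by (rule commutator_least(2)[OF alg sub]) simp_all
    have "is_congruence A ?F ?C"
      by (rule commutator_least(1)[OF alg sub]) simp_all
    then have refl: "(z, z) \<in> ?C" if "z \<in> A" for z
      using that by (auto simp: is_congruence_def equiv_def refl_on_def)
    have ea: "(e, a) \<in> \<alpha> i" and aA: "a \<in> A"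
      using a by (simp_all add: N_def)
    have G: "(2, binary m) \<in> ?G"
      by (simp add: groupoid_operations_def)
    have proj: "term_operation A ?G 3 (\<lambda>xs. xs ! 0)" "term_operation A ?G 3 (\<lambda>xs. xs ! 1)"
        "term_operation A ?G 3 (\<lambda>xs. xs ! 2)"
      by (rule term_operation.proj; simp)+
    have pol: "polynomial_operation A ?F 3 (\<lambda>xs. m (m (xs ! 0) (xs ! 1)) (xs ! 2))"
      "polynomial_operation A ?F 3 (\<lambda>xs. m (xs ! 1) (m (xs ! 0) (xs ! 2)))"
      unfolding polynomial_operation_def
      by (rule term_operation_binary[OF G term_operation_binary[OF G proj(1,2)] proj(3)]
          term_operation_binary[OF G proj(2) term_operation_binary[OF G proj(1,3)]])+
    have "(m (m a x) y, m (m a (m x y)) e) \<in> ?C"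
      using term_condition_binary[OF tc _ ea, of "[x, y]" "\<lambda>xs. m (m (xs ! 0) (xs ! 1)) (xs ! 2)" "[m x y, e]"]
        pol(1) xy by (simp add: closed unit_mem left_unit right_unit refl numeral_3_eq_3)
    moreover have "(m x (m a y), m e (m a (m x y))) \<in> ?C"
      using term_condition_binary[OF tc _ ea, of "[x, y]" "\<lambda>xs. m (xs ! 1) (m (xs ! 0) (xs ! 2))" "[e, m x y]"]
        pol(2) xy by (simp add: closed unit_mem left_unit right_unit refl numeral_3_eq_3)
    moreover have "\<exists>z\<in>N (Suc i). w = m b z" if wb: "(w, b) \<in> ?C" "w \<in> A" "b \<in> A" for w b
    proof -
      obtain z where z: "z \<in> A" "m b z = w"
        using left_solve[OF wb(3,2)] by blast
      have "(m b z, m b e) \<in> \<alpha> (Suc i)"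
        using com i wb z by (auto simp: right_unit)
      then have "(z, e) \<in> \<alpha> (Suc i)"
        using congruence_left_cancel[of "\<alpha> (Suc i)"] cong i z wb unit_mem by simp
      then have "(e, z) \<in> \<alpha> (Suc i)"
        using cong[rule_format, of "Suc i"] i by (auto simp: is_congruence_def equiv_def dest: symD)
      then show ?thesis
        using z by (auto simp: N_def)
    qed
    ultimately show "\<exists>z\<in>N (Suc i). m (m a x) y = m (m a (m x y)) z"
      "\<exists>z\<in>N (Suc i). m x (m a y) = m (m a (m x y)) z"
      using aA xy by (simp_all add: closed unit_mem left_unit right_unit)
  qed
  then show thesis
    by (rule that)
qed

end

text \<open>The action of a central element of prime order. The cyclic group generated by \<open>L\<close> acts freely, the
  quotient loop lives on orbit representatives, and the position in the orbit is the
  coordinate that is added below those of the quotient.\<close>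

locale central_translation = finite_loop +
  fixes L :: "'a \<Rightarrow> 'a" and q :: nat
  assumes prime: "prime q"
    and L_closed: "\<And>x. x \<in> A \<Longrightarrow> L x \<in> A"
    and L_left: "\<And>x y. x \<in> A \<Longrightarrow> y \<in> A \<Longrightarrow> m (L x) y = L (m x y)"
    and L_right: "\<And>x y. x \<in> A \<Longrightarrow> y \<in> A \<Longrightarrow> m x (L y) = L (m x y)"
    and L_order: "\<And>x. x \<in> A \<Longrightarrow> (L ^^ q) x = x"
    and L_free: "\<And>x. x \<in> A \<Longrightarrow> L x \<noteq> x"
begin

lemma pow_closed: "x \<in> A \<Longrightarrow> (L ^^ j) x \<in> A"
  by (induction j) (auto intro: L_closed)

lemma pow_left: "x \<in> A \<Longrightarrow> y \<in> A \<Longrightarrow> m ((L ^^ j) x) y = (L ^^ j) (m x y)"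
  by (induction j) (auto simp: L_left pow_closed)

lemma pow_right: "x \<in> A \<Longrightarrow> y \<in> A \<Longrightarrow> m x ((L ^^ j) y) = (L ^^ j) (m x y)"
  by (induction j) (auto simp: L_right pow_closed)

lemma pow_multiple: "x \<in> A \<Longrightarrow> (L ^^ (j * q)) x = x"
  by (induction j) (auto simp: funpow_add L_order)

lemma pow_mod: "x \<in> A \<Longrightarrow> (L ^^ (j mod q)) x = (L ^^ j) x"
  using funpow_add[of "j mod q" "j div q * q" L] pow_multiple[of x "j div q"] by simp

lemma pow_cong: "x \<in> A \<Longrightarrow> [i = j] (mod q) \<Longrightarrow> (L ^^ i) x = (L ^^ j) x"
  using pow_mod[of x i] pow_mod[of x j] by (simp add: cong_def)

lemma pow_inj: "x \<in> A \<Longrightarrow> y \<in> A \<Longrightarrow> (L ^^ j) x = (L ^^ j) y \<Longrightarrow> x = y"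
proof (induction j)
  case (Suc j)
  have inj: "u = v" if "u \<in> A" "v \<in> A" "L u = L v" for u v
  proof -
    have "(L ^^ q) u = (L ^^ q) v"
      using that prime prime_gt_0_nat[of q] by (cases q) (simp_all add: funpow_swap1)
    then show ?thesis
      using that L_order by simp
  qed
  have "(L ^^ j) x = (L ^^ j) y"
    using Suc.prems by (intro inj[OF pow_closed pow_closed]) simp_all
  then show ?case
    using Suc by blast
qed simp

lemma pow_fixed:
  assumes x: "x \<in> A" and eq: "(L ^^ d) x = x"
  shows "q dvd d"
proof (rule ccontr)
  assume "\<not> q dvd d"
  then have "coprime d q"
    using prime by (metis coprime_commute prime_imp_coprime_nat)
  then obtain t where "[d * t = Suc 0] (mod q)"
    using cong_solve_coprime_nat by blast
  then have "(L ^^ (d * t)) x = L x"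
    using pow_cong[OF x, of "d * t" "Suc 0"] by simp
  moreover have "(L ^^ (t * d)) x = x"
    using eq by (induction t) (simp_all add: funpow_add)
  ultimately show False
    using L_free[OF x] by (simp add: mult.commute)
qed

lemma pow_eq_iff:
  assumes x: "x \<in> A"
  shows "(L ^^ i) x = (L ^^ j) x \<longleftrightarrow> [i = j] (mod q)"
proof
  assume eq: "(L ^^ i) x = (L ^^ j) x"
  have "[i = j] (mod q)" if "i \<le> j" "(L ^^ i) x = (L ^^ j) x" for i j
  proof -
    have "(L ^^ i) x = (L ^^ i) ((L ^^ (j - i)) x)"
      using that funpow_add[of i "j - i" L] by simp
    then have "x = (L ^^ (j - i)) x"
      by (rule pow_inj[OF x pow_closed[OF x]])
    then have "q dvd j - i"
      by (intro pow_fixed[OF x]) (rule sym)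
    then show ?thesis
      using that(1) cong_altdef_nat[of i j q] by (simp add: cong_sym_eq)
  qed
  then show "[i = j] (mod q)"
    using eq cong_sym[of j i q] by (cases "i \<le> j") simp_all
qed (rule pow_cong[OF x])

definition orbit :: "'a \<Rightarrow> 'a set" where
  "orbit x = range (\<lambda>j. (L ^^ j) x)"

definition rep :: "'a \<Rightarrow> 'a" where
  "rep x = (SOME y. y \<in> orbit x)"

text \<open>This exponent is unique modulo \<open>q\<close>, so that any choice serves as a coordinate.\<close>

definition shift :: "'a \<Rightarrow> nat" where
  "shift x = (SOME j. x = (L ^^ j) (rep x))"

lemma orbit_pow: 
  assumes "x \<in> A"
  shows "orbit ((L ^^ j) x) = orbit x"
proof
  have "(L ^^ i) ((L ^^ j) x) = (L ^^ (i + j)) x" for i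
    by (simp add: funpow_add)
  then show "orbit ((L ^^ j) x) \<subseteq> orbit x"
    by (auto simp: orbit_def)
  have expand: "(L ^^ i) x = (L ^^ (i + (q - 1) * j)) ((L ^^ j) x)" for i
  proof -
    have "i + (q - 1) * j + j = i + j * q"
      using prime prime_gt_0_nat[of q] by (cases q) (simp_all add: algebra_simps)
    moreover have "(L ^^ (i + j * q)) x = (L ^^ i) x"
      using pow_multiple[OF assms, of j] by (simp add: funpow_add)
    ultimately show ?thesis
      using funpow_add[of "i + (q - 1) * j" j L] by (metis comp_apply)
  qed
  show "orbit x \<subseteq> orbit ((L ^^ j) x)"
    unfolding orbit_def by (intro image_subsetI, subst expand) (rule rangeI)
qed

lemma self_orbit: "x \<in> orbit x"
  unfolding orbit_def by (rule range_eqI[of _ _ 0]) simp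

lemma rep_pow: "x \<in> A \<Longrightarrow> rep ((L ^^ j) x) = rep x"
  by (simp add: rep_def orbit_pow)

lemma rep_orbit: "rep x \<in> orbit x"
  unfolding rep_def using someI[of "\<lambda>y. y \<in> orbit x", OF self_orbit] .

lemma rep_closed: "x \<in> A \<Longrightarrow> rep x \<in> A"
  using rep_orbit[of x] pow_closed by (auto simp: orbit_def)

lemma rep_rep: "x \<in> A \<Longrightarrow> rep (rep x) = rep x"
  using rep_orbit[of x] rep_pow by (auto simp: orbit_def)

lemma shift: "x \<in> A \<Longrightarrow> (L ^^ shift x) (rep x) = x"
proof -
  assume x: "x \<in> A"
  obtain i where "rep x = (L ^^ i) x"
    using rep_orbit by (auto simp: orbit_def)
  then have "orbit (rep x) = orbit x"
    using orbit_pow x by simp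
  then have "x \<in> orbit (rep x)"
    using self_orbit by simp
  then have "\<exists>j. x = (L ^^ j) (rep x)"
    by (auto simp: orbit_def)
  then show ?thesis
    unfolding shift_def by (rule someI_ex[THEN sym])
qed

lemma mult_rep:
  assumes "x \<in> A" "y \<in> A"
  shows "m x y = (L ^^ (shift x + shift y)) (m (rep x) (rep y))"
proof -
  have "m ((L ^^ shift x) (rep x)) ((L ^^ shift y) (rep y)) = (L ^^ (shift x + shift y)) (m (rep x) (rep y))"
    using pow_left[of "rep x" "(L ^^ shift y) (rep y)" "shift x"] pow_right[of "rep x" "rep y" "shift y"] assms
    by (simp add: pow_closed rep_closed funpow_add)
  then show ?thesis
    using assms by (simp add: shift)
qed

lemma rep_eq_pow:
  assumes "x \<in> A" "rep x = rep y"
  obtains i where "x = (L ^^ i) y"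
proof -
  obtain i where "rep y = (L ^^ i) y"
    using rep_orbit by (auto simp: orbit_def)
  then have "x = (L ^^ (shift x + i)) y"
    using shift[OF assms(1)] assms(2) by (simp add: funpow_add)
  then show thesis
    by (rule that)
qed

lemma rep_mult:
  assumes "x \<in> A" "y \<in> A"
  shows "rep (m (rep x) (rep y)) = rep (m x y)"
  using assms by (simp add: mult_rep[of x y] rep_pow rep_closed closed)

text \<open>The last summand depends only on the orbits of \<open>x\<close> and \<open>y\<close>; it is the cocycle of the central
  extension.\<close>

lemma shift_mult:
  assumes "x \<in> A" "y \<in> A"
  shows "[shift (m x y) = shift x + shift y + shift (m (rep x) (rep y))] (mod q)"
proof -
  let ?z = "m (rep x) (rep y)"
  have "(L ^^ shift (m x y)) (rep (m x y)) = m x y"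
    using assms by (simp add: shift closed)
  also have "\<dots> = (L ^^ (shift x + shift y)) ?z"
    using assms by (rule mult_rep)
  also have "?z = (L ^^ shift ?z) (rep (m x y))"
    using shift[of ?z] assms by (simp add: rep_mult rep_closed closed)
  finally have "(L ^^ shift (m x y)) (rep (m x y)) = (L ^^ (shift x + shift y + shift ?z)) (rep (m x y))"
    by (simp add: funpow_add)
  then show ?thesis
    using assms by (simp add: pow_eq_iff rep_closed closed)
qed

lemma finite_loop_quotient: "finite_loop (rep ` A) (\<lambda>x y. rep (m x y)) (rep e)"
proof
  show "finite (rep ` A)"
    by (simp add: finite)
  show "rep (m (rep e) x) = x" "rep (m x (rep e)) = x" if "x \<in> rep ` A" for x
    using that by (auto simp: rep_mult unit_mem left_unit right_unit)
  have eq: "x = y" if "x \<in> rep ` A" "y \<in> rep ` A" "rep x = rep y" for x y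
    using that by (auto simp: rep_rep)
  show "x = y" if h: "a \<in> rep ` A" "x \<in> rep ` A" "y \<in> rep ` A" "rep (m a x) = rep (m a y)" for a x y
  proof -
    have A: "a \<in> A" "x \<in> A" "y \<in> A"
      using h rep_closed by auto
    then obtain i where "m a x = (L ^^ i) (m a y)"
      using rep_eq_pow[OF closed h(4)] by blast
    then have "m a x = m a ((L ^^ i) y)"
      using A by (simp add: pow_right)
    then have "x = (L ^^ i) y"
      by (rule left_cancel[OF A(1,2) pow_closed[OF A(3)]])
    then show ?thesis
      using eq[OF h(2,3)] A by (simp add: rep_pow)
  qed
  show "x = y" if h: "a \<in> rep ` A" "x \<in> rep ` A" "y \<in> rep ` A" "rep (m x a) = rep (m y a)" for a x y
  proof -
    have A: "a \<in> A" "x \<in> A" "y \<in> A"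
      using h rep_closed by auto
    then obtain i where "m x a = (L ^^ i) (m y a)"
      using rep_eq_pow[OF closed h(4)] by blast
    then have "m x a = m ((L ^^ i) y) a"
      using A by (simp add: pow_left)
    then have "x = (L ^^ i) y"
      by (rule right_cancel[OF A(1,2) pow_closed[OF A(3)]])
    then show ?thesis
      using eq[OF h(2,3)] A by (simp add: rep_pow)
  qed
qed (auto simp: rep_closed closed unit_mem)

lemma central_series_quotient:
  assumes "central_series A m e N k"
  shows "central_series (rep ` A) (\<lambda>x y. rep (m x y)) (rep e) (\<lambda>i. rep ` N i) k"
  unfolding central_series_def
proof (intro conjI allI impI ballI)
  have N: "N 0 = A" "N k \<subseteq> {e}" "\<And>i. N i \<subseteq> A"
    using assms by (simp_all add: central_series_def)
  show "rep ` N 0 = rep ` A" "rep ` N k \<subseteq> {rep e}" "rep ` N i \<subseteq> rep ` A" for i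
    using N by auto
  fix i a x y assume i: "i < k" "a \<in> rep ` N i" "x \<in> rep ` A" "y \<in> rep ` A"
  then obtain a' x' y' where eqs: "a = rep a'" "x = rep x'" "y = rep y'" and mem: "a' \<in> N i" "x' \<in> A" "y' \<in> A"
    by blast
  have aA: "a' \<in> A"
    using mem N by blast
  obtain z where z: "z \<in> N (Suc i)" "m (m a' x') y' = m (m a' (m x' y')) z"
    using central_seriesD[OF assms i(1) mem] by blast
  have zA: "z \<in> A"
    using z N by blast
  have "rep (m (rep (m a x)) y) = rep (m (rep (m a (rep (m x y)))) (rep z))"
    using aA mem z zA by (simp add: eqs rep_mult closed)
  then show "\<exists>z\<in>rep ` N (Suc i). rep (m (rep (m a x)) y) = rep (m (rep (m a (rep (m x y)))) z)"
    using z by blast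
  obtain w where w: "w \<in> N (Suc i)" "m x' (m a' y') = m (m a' (m x' y')) w"
    using central_seriesD[OF assms i(1) mem] by blast
  have wA: "w \<in> A"
    using w N by blast
  have "rep (m x (rep (m a y))) = rep (m (rep (m a (rep (m x y)))) (rep w))"
    using aA mem w wA by (simp add: eqs rep_mult closed)
  then show "\<exists>z\<in>rep ` N (Suc i). rep (m x (rep (m a y))) = rep (m (rep (m a (rep (m x y)))) z)"
    using w by blast
qed

lemma card_quotient: "card (rep ` A) < card A"
proof (rule psubset_card_mono[OF finite], rule psubsetI)
  show "rep ` A \<subseteq> A"
    by (auto simp: rep_closed)
  show "rep ` A \<noteq> A"
  proof
    assume eq: "rep ` A = A"
    have "rep x = x" if "x \<in> A" for x
    proof -
      have "x \<in> rep ` A" using that eq by simp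
      then show ?thesis using rep_rep by auto
    qed
    moreover have "rep (L e) = rep e"
      using rep_pow[OF unit_mem, of 1] by simp
    ultimately show False
      using L_free L_closed unit_mem by metis
  qed
qed

lemma extend_coordinates:
  assumes "loop_coordinates (rep ` A) (\<lambda>x y. rep (m x y)) (rep e) n p \<kappa> (\<lambda>i. {..<i})"
  shows "loop_coordinates A m e (Suc n) (p(n := q))
    (\<lambda>i x. if i < n then \<kappa> i (rep x) else int (shift x)) (\<lambda>i. {..<i})"
    (is "loop_coordinates _ _ _ _ ?p ?\<kappa> _")
proof -
  interpret Q: loop_coordinates "rep ` A" "\<lambda>x y. rep (m x y)" "rep e" n p \<kappa> "\<lambda>i. {..<i}"
    by (fact assms)
  have agree: "agree ?p ?\<kappa> {..<i} x y \<longleftrightarrow> agree p \<kappa> {..<i} (rep x) (rep y)" if "i \<le> n" for i x y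
    using that by (auto simp: agree_def)
  have sep: "rep x = rep y" if "x \<in> A" "y \<in> A" "agree ?p ?\<kappa> {..<n} x y" for x y
    using that by (intro Q.separate) (simp_all add: agree)
  show ?thesis
  proof
    show "prime (?p i)" if "i < Suc n" for i
      using that prime Q.prime by (auto simp: less_Suc_eq)
    show "x = y" if "x \<in> A" "y \<in> A" "agree ?p ?\<kappa> {..<Suc n} x y" for x y
    proof -
      have "rep x = rep y"
        using that agree_mono[OF that(3), of "{..<n}"] by (intro sep) auto
      moreover have "[int (shift x) = int (shift y)] (mod int q)"
        using bspec[OF that(3)[unfolded agree_def], of n] by simp
      ultimately show ?thesis
        using shift[OF that(1)] shift[OF that(2)] pow_cong[OF rep_closed[OF that(1)], of "shift x" "shift y"]
        by (simp add: cong_int_iff)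
    qed
    fix i x x' y y'
    assume i: "i < Suc n" and A: "x \<in> A" "x' \<in> A" "y \<in> A" "y' \<in> A"
      and x: "agree ?p ?\<kappa> {..<i} x x'" and y: "agree ?p ?\<kappa> {..<i} y y'"
    show "[?\<kappa> i (m x y) - ?\<kappa> i (m x' y') = (?\<kappa> i x - ?\<kappa> i x') + (?\<kappa> i y - ?\<kappa> i y')] (mod int (?p i))"
    proof (cases "i < n")
      case True
      then show ?thesis
        using Q.additive[of i "rep x" "rep x'" "rep y" "rep y'"] A x y by (simp add: agree rep_mult)
    next
      case False
      then have [simp]: "i = n"
        using i by simp
      have "rep x = rep x'" "rep y = rep y'"
        using sep[OF A(1,2)] sep[OF A(3,4)] x y by simp_all
      then have "[int (shift (m x y)) - int (shift (m x' y'))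
          = int (shift x + shift y + shift (m (rep x) (rep y)))
          - int (shift x' + shift y' + shift (m (rep x) (rep y)))] (mod int q)"
        using shift_mult[OF A(1,3)] shift_mult[OF A(2,4)] by (intro cong_diff) (simp_all only: cong_int_iff)
      then show ?thesis
        by (simp add: algebra_simps)
    qed
  qed (auto simp: finite closed unit_mem left_unit right_unit)
qed

end

text \<open>Let \<open>a \<noteq> e\<close> belong to the last nontrivial term of the series. Multiplication by \<open>a\<close> commutes with all
  translations, and a suitable power \<open>L\<close> of it has prime order. The order is that of the orbit of \<open>e\<close>, since
  \<open>T\<^sup>d x = (T\<^sup>d e) x\<close>; this also shows that the action is free.\<close>

lemma (in finite_loop) exists_central_translation:
  assumes N: "central_series A m e N k" and A: "A \<noteq> {e}"
  obtains L q where "central_translation A m e L q"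
proof -
  have ends: "N 0 = A" "N k \<subseteq> {e}" and NA: "\<And>i. N i \<subseteq> A"
    using N by (simp_all add: central_series_def)
  define j where "j = (LEAST j. N j \<subseteq> {e})"
  have j: "N j \<subseteq> {e}" "j \<le> k"
    unfolding j_def using LeastI[of "\<lambda>j. N j \<subseteq> {e}" k] Least_le[of "\<lambda>j. N j \<subseteq> {e}" k] ends(2) by simp_all
  have "\<not> N 0 \<subseteq> {e}"
    using ends A unit_mem by auto
  then obtain i where i: "j = Suc i"
    using j by (cases j) auto
  then have "\<not> N i \<subseteq> {e}"
    using not_less_Least[of i "\<lambda>j. N j \<subseteq> {e}"] by (simp add: j_def)
  then obtain a where a: "a \<in> N i" "a \<noteq> e"
    by blast
  have aA: "a \<in> A"
    using a NA by blast
  have "m (m a x) y = m (m a (m x y)) e \<and> m x (m a y) = m (m a (m x y)) e" if "x \<in> A" "y \<in> A" for x y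
    using central_seriesD[OF N _ a(1) that] j i by auto
  then have T: "m (m a x) y = m a (m x y)" "m x (m a y) = m a (m x y)" if "x \<in> A" "y \<in> A" for x y
    using that aA by (simp_all add: closed right_unit)
  define T where "T = m a"
  have pA: "(T ^^ j) x \<in> A" if "x \<in> A" for j x
    using that aA by (induction j) (auto simp: T_def closed)
  have pl: "m ((T ^^ j) x) y = (T ^^ j) (m x y)" and pr: "m x ((T ^^ j) y) = (T ^^ j) (m x y)"
    if "x \<in> A" "y \<in> A" for j x y
    using that by (induction j) (simp_all add: T_def T pA[unfolded T_def] closed)
  have inj: "x = y" if "x \<in> A" "y \<in> A" "(T ^^ j) x = (T ^^ j) y" for j x y
    using that
  proof (induction j)
    case (Suc j)
    then show ?case
      using left_cancel[OF aA pA pA] by (simp add: T_def)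
  qed simp
  have "T ` A \<subseteq> A"
    using pA[of _ 1] by auto
  then obtain M where M: "M > 0" "(T ^^ M) ((T ^^ M) e) = (T ^^ M) e"
    using idempotent_iterate[OF finite] unit_mem by metis
  define d where "d = (LEAST d. d > 0 \<and> (T ^^ d) e = e)"
  have "(T ^^ M) e = e"
    using inj[OF pA unit_mem M(2)] unit_mem by simp
  then have d: "d > 0" "(T ^^ d) e = e"
    unfolding d_def using LeastI[of "\<lambda>d. d > 0 \<and> (T ^^ d) e = e" M] M by auto
  have d_least: "(T ^^ c) e \<noteq> e" if "0 < c" "c < d" for c
    using that not_less_Least[of c "\<lambda>d. d > 0 \<and> (T ^^ d) e = e"] by (auto simp: d_def)
  have "d \<noteq> 1"
    using d(2) a aA by (auto simp: T_def right_unit)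
  then obtain q where q: "prime q" "q dvd d"
    using prime_factor_nat by blast
  then obtain c where c: "d = q * c"
    by blast
  then have c0: "0 < c" "c < d"
    using d q prime_gt_1_nat[OF q(1)] by auto
  have "central_translation A m e (T ^^ c) q"
  proof
    show "((T ^^ c) ^^ q) x = x" if "x \<in> A" for x
    proof -
      have "((T ^^ c) ^^ q) x = (T ^^ d) (m e x)"
        using that by (simp add: c funpow_mult mult.commute left_unit)
      also have "\<dots> = m ((T ^^ d) e) x"
        using that unit_mem by (simp add: pl)
      finally show ?thesis
        using that by (simp add: d left_unit)
    qed
    show "(T ^^ c) x \<noteq> x" if "x \<in> A" for x
    proof
      assume eq: "(T ^^ c) x = x"
      have "m ((T ^^ c) e) x = m e x"
        using that eq by (simp add: pl unit_mem left_unit)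
      then have "(T ^^ c) e = e"
        using right_cancel that unit_mem pA by blast
      then show False
        using d_least c0 by blast
    qed
  qed (simp_all add: q pA pl pr)
  then show thesis
    by (rule that)
qed

text \<open>Induction on the order: the coordinates of the quotient by a central translation come first and
  the position in the orbit comes last.\<close>

lemma exists_coordinates:
  assumes "finite_loop A m e" "central_series A m e N k"
  shows "\<exists>n p \<kappa>. loop_coordinates A m e n p \<kappa> (\<lambda>i. {..<i})"
  using assms
proof (induction "card A" arbitrary: A m e N rule: less_induct)
  case less
  interpret finite_loop A m e
    by (fact less.prems(1))
  show ?case
  proof (cases "A = {e}")
    case True
    have "loop_coordinates A m e 0 (\<lambda>_. 2) (\<lambda>_ _. 0) (\<lambda>i. {..<i})"
      by unfold_locales (use True finite closed unit_mem left_unit right_unit in auto)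
    then show ?thesis by blast
  next
    case False
    then obtain L q where "central_translation A m e L q"
      using exists_central_translation less.prems(2) by blast
    then interpret central_translation A m e L q .
    obtain n p \<kappa> where "loop_coordinates (rep ` A) (\<lambda>x y. rep (m x y)) (rep e) n p \<kappa> (\<lambda>i. {..<i})"
      using less.hyps[OF card_quotient finite_loop_quotient central_series_quotient[OF less.prems(2)]] by blast
    then show ?thesis
      using extend_coordinates by blast
  qed
qed

section \<open>The supernilpotent reduct\<close>

theorem theorem1p1:
  fixes A :: "'a set" and mult :: "'a \<Rightarrow> 'a \<Rightarrow> 'a"
  assumes "finite A"
    and "is_loop A mult"
    and "is_nilpotent A (groupoid_operations mult)"
  shows "\<exists>star :: 'a \<Rightarrow> 'a \<Rightarrow> 'a.
           term_operation A (groupoid_operations mult) 2 (binary star) \<and>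
           is_loop A star \<and>
           is_supernilpotent A (groupoid_operations star)"
proof -
  let ?F = "groupoid_operations mult"
  obtain e where loop: "finite_loop A mult e"
    using assms(1,2) by (rule finite_loop_if_is_loop)
  obtain N k where series: "central_series A mult e N k"
    by (rule finite_loop.nilpotent_central_series[OF loop assms(3)])
  obtain n p \<kappa> where "loop_coordinates A mult e n p \<kappa> (\<lambda>i. {..<i})"
    using exists_coordinates[OF loop series] by (elim exE) (rule that)
  from loop_coordinates.separate_primes[OF this refl le_refl, where 'b = "'a list"]
  obtain star \<kappa>' where
    coords: "loop_coordinates A star e n p \<kappa>' (\<lambda>i. {j. j < i \<and> (i < n \<longrightarrow> p j = p i)})"
    and derived: "\<forall>C :: ('a list \<Rightarrow> 'a) set. pointwise_closed mult C \<longrightarrow> pointwise_closed star C"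
    by (elim exE conjE) (rule that)
  let ?C = "{f. term_operation A ?F 2 f}"
  have "pointwise_closed mult ?C"
    by (auto simp: pointwise_closed_def groupoid_operations_def intro: term_operation_binary)
  then have "pointwise_closed star ?C"
    by (rule derived[rule_format])
  moreover have "(\<lambda>xs. xs ! 0) \<in> ?C" "(\<lambda>xs. xs ! 1) \<in> ?C"
    by (simp_all add: term_operation.proj)
  ultimately have "(\<lambda>xs. star (xs ! 0) (xs ! 1)) \<in> ?C"
    by (rule pointwise_closedD)
  moreover have "binary star = (\<lambda>xs. star (xs ! 0) (xs ! 1))"
    by (simp add: fun_eq_iff binary_def)
  ultimately have "term_operation A ?F 2 (binary star)"
    by simp
  moreover have "is_loop A star"
    using coords by (rule loop_coordinates.is_loop)
  moreover have "is_supernilpotent A (groupoid_operations star)"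
    using coords by (rule loop_coordinates.is_supernilpotent) simp
  ultimately show ?thesis
    by blast
qed

end
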